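(* Let $T$ and $P$ be as in the context, with root $o$. Let either $\lambda\in\mathrm{res}^*(P)$, or $\lambda=\pm\rho$ in the case that the random walk is $\rho$-transient. A function $h:T\to\mathbb{C}$ satisfies $Ph=\lambda h$, with all defining sums absolutely convergent, if and only if there is a complex distribution $\nu$ on $\{\partial T_x:x\in T\}$ such that $$h(x)=\int_{\partial T}K(x,\xi\mid\lambda)\,d\nu(\xi)\quad\text{for all }x\in T.$$ The distribution $\nu$ is uniquely determined by $h$: $\nu=\nu^h$, where $\nu^h(\partial T)=h(o)$ and, for $x\ne o$, $$\nu^h(\partial T_x)=F(o,x\mid\lambda)\,\frac{h(x)-F(x,x^-\mid\lambda)\,h(x^-)}{1-F(x^-,x\mid\lambda)\,F(x,x^-\mid\lambda)}.$$
   Context: $T$ is a countable tree; vertices may have countably infinite degree, and no vertex has degree $1$. Write $x\sim y$ for neighbours. $P=(p(x,y))$ is stochastic with $p(x,y)>0$ iff $x\sim y$, and $Pf(x)=\sum_y p(x,y)f(y)$ is required to converge absolutely. Spectral data: $p^{(n)}(x,y)$ are the entries of $P^n$, and $\rho=\limsup_n p^{(n)}(x,y)^{1/n}$. For $|\lambda|>\rho$, $G(x,y\mid\lambda)=\sum_{n\ge0}p^{(n)}(x,y)\lambda^{-n-1}$. The walk is $\rho$-transient if this series converges at $\lambda=\rho$; in that case $G(x,y\mid\pm\rho)$ is defined by the (absolutely convergent) series. Fix the root $o$. Let $\mathsf m(x)=\prod_{i=1}^k p(x_{i-1},x_i)/p(x_i,x_{i-1})$ for $\pi(o,x)=[x_0,\dots,x_k]$.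 Then $P$ is a bounded self-adjoint operator on $\ell^2(T,\mathsf m)$; put $\mathrm{res}(P)=\mathbb{C}\setminus\mathrm{spec}(P)$. For $\lambda\in\mathrm{res}(P)$, $G(x,y\mid\lambda)=((\lambda I-P)^{-1}\mathbf 1_y)(x)$, which agrees with the series for $|\lambda|>\rho$. Let $\mathrm{res}^*(P)=\{\lambda\in\mathrm{res}(P):G(x,x\mid\lambda)\ne0\ \forall x\}$. For the admissible $\lambda$, set $F(x,y\mid\lambda)=G(x,y\mid\lambda)/G(y,y\mid\lambda)$. Boundary: $\partial T$ is the set of ends (equivalence classes of geodesic rays differing in finitely many initial vertices). $\pi(x,w)$ denotes a geodesic. $x\wedge w$ is the last common vertex of $\pi(o,x)$ and $\pi(o,w)$. $x^-$ is the neighbour of $x\ne o$ closer to $o$. $T_x=\{w:x\in\pi(o,w)\}$ with $T_o=T$, and $\partial T_x$ is the set of ends represented by rays in $T_x$. Martin kernel: $K(x,w\mid\lambda)=G(x,x\wedge w\mid\lambda)/G(o,x\wedge w\mid\lambda)$ for $x\in T$, $w\in T\cup\partial T$. A complex distribution is a map $\nu:\{\partial T_x\}\to\mathbb{C}$ with $\nu(\partial T_x)=\sum_{y^-=x}\nu(\partial T_y)$, absolutely convergent. Integral: $\varphi$ is locally constant if for some finite subtree $\tau\ni o$ it is constant, with value $\varphi_x$, on $\partial T_x\setminus\bigcup_{y\in\tau,\,y^-=x}\partial T_y$ for each $x\in\tau$. Then $\int\varphi\,d\nu=\sum_{x\in\tau}\varphi_x\bigl(\nu(\partial T_x)-\sum_{y\in\tau,\,y^-=x}\nu(\partial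 T_y)\bigr)$, which is independent of $\tau$. The function $\xi\mapsto K(x,\xi\mid\lambda)$ is locally constant, with $\tau=\pi(o,x)$. *)

theory Defs
  imports "HOL-Analysis.Analysis" "HOL-Library.Liminf_Limsup"
begin

definition is_path :: "('v \<Rightarrow> 'v \<Rightarrow> bool) \<Rightarrow> 'v list \<Rightarrow> bool" where
  "is_path adj xs \<longleftrightarrow> xs \<noteq> [] \<and> distinct xs \<and>
     (\<forall>i. Suc i < length xs \<longrightarrow> adj (xs ! i) (xs ! Suc i))"

definition is_tree :: "('v \<Rightarrow> 'v \<Rightarrow> bool) \<Rightarrow> bool" where
  "is_tree adj \<longleftrightarrow>
     (\<forall>x y. adj x y \<longrightarrow> adj y x) \<and> (\<forall>x. \<not> adj x x) \<and>
     (\<forall>x y. adj\<^sup>*\<^sup>* x y) \<and>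
     \<not> (\<exists>xs. is_path adj xs \<and> length xs \<ge> 3 \<and> adj (last xs) (hd xs))"

definition geo :: "('v \<Rightarrow> 'v \<Rightarrow> bool) \<Rightarrow> 'v \<Rightarrow> 'v \<Rightarrow> 'v set" where
  "geo adj x w = {z. \<exists>xs. is_path adj xs \<and> hd xs = x \<and> last xs = w \<and> z \<in> set xs}"

definition geo_list :: "('v \<Rightarrow> 'v \<Rightarrow> bool) \<Rightarrow> 'v \<Rightarrow> 'v \<Rightarrow> 'v list" where
  "geo_list adj x w = (THE xs. is_path adj xs \<and> hd xs = x \<and> last xs = w)"

definition tdist :: "('v \<Rightarrow> 'v \<Rightarrow> bool) \<Rightarrow> 'v \<Rightarrow> 'v \<Rightarrow> nat" where
  "tdist adj x w = length (geo_list adj x w) - 1"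

definition subT :: "('v \<Rightarrow> 'v \<Rightarrow> bool) \<Rightarrow> 'v \<Rightarrow> 'v \<Rightarrow> 'v set" where
  "subT adj rt x = {w. x \<in> geo adj rt w}"

definition pred :: "('v \<Rightarrow> 'v \<Rightarrow> bool) \<Rightarrow> 'v \<Rightarrow> 'v \<Rightarrow> 'v" where
  "pred adj rt x = (THE y. adj x y \<and> y \<in> geo adj rt x)"

definition children :: "('v \<Rightarrow> 'v \<Rightarrow> bool) \<Rightarrow> 'v \<Rightarrow> 'v \<Rightarrow> 'v set" where
  "children adj rt x = {y. y \<noteq> rt \<and> pred adj rt y = x}"

definition geo_ray :: "('v \<Rightarrow> 'v \<Rightarrow> bool) \<Rightarrow> (nat \<Rightarrow> 'v) \<Rightarrow> bool" where
  "geo_ray adj r \<longleftrightarrow> inj r \<and> (\<forall>n. adj (r n) (r (Suc n)))"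

definition ray_equiv :: "(nat \<Rightarrow> 'v) \<Rightarrow> (nat \<Rightarrow> 'v) \<Rightarrow> bool" where
  "ray_equiv r r' \<longleftrightarrow> (\<exists>i j. \<forall>n. r (n + i) = r' (n + j))"

definition ends :: "('v \<Rightarrow> 'v \<Rightarrow> bool) \<Rightarrow> (nat \<Rightarrow> 'v) set set" where
  "ends adj = {{r'. geo_ray adj r' \<and> ray_equiv r r'} | r. geo_ray adj r}"

definition bdT :: "('v \<Rightarrow> 'v \<Rightarrow> bool) \<Rightarrow> 'v \<Rightarrow> 'v \<Rightarrow> (nat \<Rightarrow> 'v) set set" where
  "bdT adj rt x = {\<xi> \<in> ends adj. \<exists>r\<in>\<xi>. \<forall>n. r n \<in> subT adj rt x}"

text \<open>x \<and> \<xi> for an end \<xi>: last vertex of pi(rt,x) that lies on the ray from rt to \<xi>,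
  i.e. the vertex z of pi(rt,x) farthest from rt with \<xi> in \<partial>T_z.\<close>
definition meet_end :: "('v \<Rightarrow> 'v \<Rightarrow> bool) \<Rightarrow> 'v \<Rightarrow> 'v \<Rightarrow> (nat \<Rightarrow> 'v) set \<Rightarrow> 'v" where
  "meet_end adj rt x \<xi> = (THE z. z \<in> geo adj rt x \<and> \<xi> \<in> bdT adj rt z \<and>
      (\<forall>z'\<in>geo adj rt x. \<xi> \<in> bdT adj rt z' \<longrightarrow> tdist adj rt z' \<le> tdist adj rt z))"

definition complex_distribution ::
  "('v \<Rightarrow> 'v \<Rightarrow> bool) \<Rightarrow> 'v \<Rightarrow> ((nat \<Rightarrow> 'v) set set \<Rightarrow> complex) \<Rightarrow> bool" where
  "complex_distribution adj rt \<nu> \<longleftrightarrow>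
     (\<forall>x. ((\<lambda>y. norm (\<nu> (bdT adj rt y))) summable_on (children adj rt x)) \<and>
          \<nu> (bdT adj rt x) = (\<Sum>\<^sub>\<infinity>y\<in>children adj rt x. \<nu> (bdT adj rt y)))"

definition finite_rooted_subtree :: "('v \<Rightarrow> 'v \<Rightarrow> bool) \<Rightarrow> 'v \<Rightarrow> 'v set \<Rightarrow> bool" where
  "finite_rooted_subtree adj rt \<tau> \<longleftrightarrow> finite \<tau> \<and> rt \<in> \<tau> \<and>
     (\<forall>x\<in>\<tau>. x \<noteq> rt \<longrightarrow> pred adj rt x \<in> \<tau>)"

definition piece :: "('v \<Rightarrow> 'v \<Rightarrow> bool) \<Rightarrow> 'v \<Rightarrow> 'v set \<Rightarrow> 'v \<Rightarrow> (nat \<Rightarrow> 'v) set set" where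
  "piece adj rt \<tau> x = bdT adj rt x - (\<Union>y\<in>\<tau> \<inter> children adj rt x. bdT adj rt y)"

text \<open>Integral of a locally constant function \<phi> on \<partial>T against \<nu>
  (well defined, i.e. independent of \<tau>, for locally constant \<phi>).\<close>
definition lc_integral ::
  "('v \<Rightarrow> 'v \<Rightarrow> bool) \<Rightarrow> 'v \<Rightarrow> ((nat \<Rightarrow> 'v) set set \<Rightarrow> complex) \<Rightarrow> ((nat \<Rightarrow> 'v) set \<Rightarrow> complex) \<Rightarrow> complex" where
  "lc_integral adj rt \<nu> \<phi> = (SOME I. \<exists>\<tau> c. finite_rooted_subtree adj rt \<tau> \<and>
      (\<forall>x\<in>\<tau>. \<forall>\<xi>\<in>piece adj rt \<tau> x. \<phi> \<xi> = c x) \<and>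
      I = (\<Sum>x\<in>\<tau>. c x * (\<nu> (bdT adj rt x) - (\<Sum>y\<in>\<tau> \<inter> children adj rt x. \<nu> (bdT adj rt y)))))"

definition stochastic_nn :: "('v \<Rightarrow> 'v \<Rightarrow> bool) \<Rightarrow> ('v \<Rightarrow> 'v \<Rightarrow> real) \<Rightarrow> bool" where
  "stochastic_nn adj p \<longleftrightarrow> (\<forall>x y. p x y \<ge> 0 \<and> (p x y > 0 \<longleftrightarrow> adj x y)) \<and>
     (\<forall>x. (p x has_sum 1) UNIV)"

fun pn :: "('v \<Rightarrow> 'v \<Rightarrow> real) \<Rightarrow> nat \<Rightarrow> 'v \<Rightarrow> 'v \<Rightarrow> real" where
  "pn p 0 x y = (if x = y then 1 else 0)"
| "pn p (Suc n) x y = (\<Sum>\<^sub>\<infinity>z. p x z * pn p n z y)"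

text \<open>\<rho> = limsup p^(n)(rt,rt)^(1/n) (independent of the chosen vertices).\<close>
definition rho :: "('v \<Rightarrow> 'v \<Rightarrow> real) \<Rightarrow> 'v \<Rightarrow> real" where
  "rho p rt = real_of_ereal (limsup (\<lambda>n. ereal (root n (pn p n rt rt))))"

definition rho_transient :: "('v \<Rightarrow> 'v \<Rightarrow> real) \<Rightarrow> 'v \<Rightarrow> bool" where
  "rho_transient p rt \<longleftrightarrow> (\<forall>x y. summable (\<lambda>n. pn p n x y / rho p rt ^ Suc n))"

definition mmeas :: "('v \<Rightarrow> 'v \<Rightarrow> bool) \<Rightarrow> ('v \<Rightarrow> 'v \<Rightarrow> real) \<Rightarrow> 'v \<Rightarrow> 'v \<Rightarrow> real" where
  "mmeas adj p rt x = (let xs = geo_list adj rt x in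
     \<Prod>i<length xs - 1. p (xs ! i) (xs ! Suc i) / p (xs ! Suc i) (xs ! i))"

definition l2m :: "('v \<Rightarrow> 'v \<Rightarrow> bool) \<Rightarrow> ('v \<Rightarrow> 'v \<Rightarrow> real) \<Rightarrow> 'v \<Rightarrow> ('v \<Rightarrow> complex) set" where
  "l2m adj p rt = {f. (\<lambda>x. mmeas adj p rt x * (cmod (f x))\<^sup>2) summable_on UNIV}"

definition Pop :: "('v \<Rightarrow> 'v \<Rightarrow> real) \<Rightarrow> ('v \<Rightarrow> complex) \<Rightarrow> 'v \<Rightarrow> complex" where
  "Pop p f x = (\<Sum>\<^sub>\<infinity>y. complex_of_real (p x y) * f y)"

text \<open>Resolvent set: \<lambda>I - P is bijective on l^2(T,m) (bounded inverse is then automatic).\<close>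
definition resP :: "('v \<Rightarrow> 'v \<Rightarrow> bool) \<Rightarrow> ('v \<Rightarrow> 'v \<Rightarrow> real) \<Rightarrow> 'v \<Rightarrow> complex set" where
  "resP adj p rt = {lam. bij_betw (\<lambda>f x. lam * f x - Pop p f x) (l2m adj p rt) (l2m adj p rt)}"

definition Gres :: "('v \<Rightarrow> 'v \<Rightarrow> bool) \<Rightarrow> ('v \<Rightarrow> 'v \<Rightarrow> real) \<Rightarrow> 'v \<Rightarrow> complex \<Rightarrow> 'v \<Rightarrow> 'v \<Rightarrow> complex" where
  "Gres adj p rt lam x y = (THE f. f \<in> l2m adj p rt \<and>
      (\<forall>z. lam * f z - Pop p f z = (if z = y then 1 else 0))) x"

definition Gser :: "('v \<Rightarrow> 'v \<Rightarrow> real) \<Rightarrow> complex \<Rightarrow> 'v \<Rightarrow> 'v \<Rightarrow> complex" where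
  "Gser p lam x y = (\<Sum>n. complex_of_real (pn p n x y) / lam ^ Suc n)"

text \<open>Green function: resolvent on res(P); power series otherwise (used at lam = \<plusminus>\<rho>).\<close>
definition Green :: "('v \<Rightarrow> 'v \<Rightarrow> bool) \<Rightarrow> ('v \<Rightarrow> 'v \<Rightarrow> real) \<Rightarrow> 'v \<Rightarrow> complex \<Rightarrow> 'v \<Rightarrow> 'v \<Rightarrow> complex" where
  "Green adj p rt lam x y = (if lam \<in> resP adj p rt then Gres adj p rt lam x y else Gser p lam x y)"

definition resP_star :: "('v \<Rightarrow> 'v \<Rightarrow> bool) \<Rightarrow> ('v \<Rightarrow> 'v \<Rightarrow> real) \<Rightarrow> 'v \<Rightarrow> complex set" where
  "resP_star adj p rt = {lam \<in> resP adj p rt. \<forall>x. Green adj p rt lam x x \<noteq> 0}"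

definition Ffun :: "('v \<Rightarrow> 'v \<Rightarrow> bool) \<Rightarrow> ('v \<Rightarrow> 'v \<Rightarrow> real) \<Rightarrow> 'v \<Rightarrow> complex \<Rightarrow> 'v \<Rightarrow> 'v \<Rightarrow> complex" where
  "Ffun adj p rt lam x y = Green adj p rt lam x y / Green adj p rt lam y y"

definition Kmartin :: "('v \<Rightarrow> 'v \<Rightarrow> bool) \<Rightarrow> ('v \<Rightarrow> 'v \<Rightarrow> real) \<Rightarrow> 'v \<Rightarrow> complex \<Rightarrow> 'v \<Rightarrow> (nat \<Rightarrow> 'v) set \<Rightarrow> complex" where
  "Kmartin adj p rt lam x \<xi> = Green adj p rt lam x (meet_end adj rt x \<xi>) / Green adj p rt lam rt (meet_end adj rt x \<xi>)"

definition nu_h :: "('v \<Rightarrow> 'v \<Rightarrow> bool) \<Rightarrow> ('v \<Rightarrow> 'v \<Rightarrow> real) \<Rightarrow> 'v \<Rightarrow> complex \<Rightarrow> ('v \<Rightarrow> complex) \<Rightarrow> 'v \<Rightarrow> complex" where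
  "nu_h adj p rt lam h x = (if x = rt then h rt else
     (let xm = pred adj rt x in
       Ffun adj p rt lam rt x * (h x - Ffun adj p rt lam x xm * h xm) /
         (1 - Ffun adj p rt lam xm x * Ffun adj p rt lam x xm)))"

definition is_eigenfun :: "('v \<Rightarrow> 'v \<Rightarrow> real) \<Rightarrow> complex \<Rightarrow> ('v \<Rightarrow> complex) \<Rightarrow> bool" where
  "is_eigenfun p lam h \<longleftrightarrow> (\<forall>x. ((\<lambda>y. norm (complex_of_real (p x y) * h y)) summable_on UNIV) \<and>
      (\<Sum>\<^sub>\<infinity>y. complex_of_real (p x y) * h y) = lam * h x)"

end

theory Submission
  imports Defs
begin

text \<open>
  Write \<open>G\<close> and \<open>F\<close> for \<open>G(\<cdot>,\<cdot>|\<lambda>)\<close> and \<open>F(\<cdot>,\<cdot>|\<lambda>)\<close>. Three properties of \<open>G\<close> suffice: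
  \<open>(\<lambda>I - P) G(\<cdot>,y) = 1\<^sub>y\<close>, \<open>G(x,x) \<noteq> 0\<close>, and \<open>G(x,y) G(w,w) = G(x,w) G(w,y)\<close> whenever \<open>w\<close> separates
  \<open>x\<close> from \<open>y\<close>. They give \<open>F(x,y) = p(x,y) G(x,x) (1 - F(x,y) F(y,x))\<close> for neighbours, so that the
  denominators do not vanish. Multiplicativity of \<open>F\<close> along geodesics turns the integral into the recursion
  \<open>h(x) = F(x,x\<^sup>-) h(x\<^sup>-) + \<nu>(\<partial>T\<^sub>x) (1 - F(x\<^sup>-,x) F(x,x\<^sup>-)) / F(o,x)\<close>, which is solved exactly by \<open>\<nu>\<^sup>h\<close>;
  and \<open>\<Sum>\<^sub>y \<nu>\<^sup>h(\<partial>T\<^sub>y) = \<nu>\<^sup>h(\<partial>T\<^sub>x) + F(o,x) G(x,x) (Ph(x) - \<lambda> h(x))\<close>, the sum being over the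
  children of \<open>x\<close>, identifies additivity of \<open>\<nu>\<^sup>h\<close> with \<open>Ph = \<lambda>h\<close>.
\<close>

section \<open>Rooted trees\<close>

text \<open>Passing through an abstract kernel is forced by the two definitions of G. On the
  resolvent set G(x,y) need not be a sum over walks, so separation is derived from uniqueness in
  \<open>l2m\<close>; for the series it comes from first passages. \<open>Green\<close> prefers the
  resolvent whenever it exists, so at \<lambda> = \<plusminus>\<rho> both branches have to be
  covered. Instead of locating \<plusminus>\<rho> in the spectrum, the resolvent branch there uses
  only |\<lambda>| = \<rho> and the positive function G(.,o|\<rho>) given by the series, which
  excludes zeros on the diagonal. Infinite degrees make convergence part of the claim. For complex
  families absolute and unconditional summability agree, and for a child y of x the value
  \<open>nu h y\<close> is a nonzero multiple of p(x,y) h(y) minus a multiple of p(x,y) G(y,x). The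
  second family is always summable, so convergence transfers in both directions before any sum is
  evaluated.\<close>

lemma is_path_iff_successively:
  "is_path adj xs \<longleftrightarrow> xs \<noteq> [] \<and> distinct xs \<and> successively adj xs"
  by (auto simp: is_path_def successively_conv_nth)

locale rooted_tree =
  fixes adj :: "'v \<Rightarrow> 'v \<Rightarrow> bool" and rt :: 'v
  assumes tree: "is_tree adj"
begin

abbreviation "par \<equiv> pred adj rt"
abbreviation "ch \<equiv> children adj rt"
abbreviation "gl \<equiv> geo_list adj rt"
abbreviation "bd \<equiv> bdT adj rt"

lemma adj_sym: "adj x y \<Longrightarrow> adj y x"
  and adj_irrefl: "\<not> adj x x"
  and adj_connected: "adj\<^sup>*\<^sup>* x y"
  and no_cycle: "is_path adj xs \<Longrightarrow> length xs \<ge> 3 \<Longrightarrow> \<not> adj (last xs) (hd xs)"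
  using tree unfolding is_tree_def by blast+

section \<open>Existence and uniqueness of geodesics\<close>

lemma path_exists: "\<exists>xs. is_path adj xs \<and> hd xs = x \<and> last xs = y"
  using adj_connected[of x y]
proof (induction rule: rtranclp_induct)
  case base
  show ?case by (rule exI[of _ "[x]"]) (simp add: is_path_iff_successively)
next
  case (step y z)
  then obtain xs where xs: "is_path adj xs" "hd xs = x" "last xs = y" by blast
  show ?case
  proof (cases "z \<in> set xs")
    case True
    then obtain as bs where "xs = as @ z # bs" by (meson split_list)
    with xs have "is_path adj (as @ [z]) \<and> hd (as @ [z]) = x \<and> last (as @ [z]) = z"
      by (auto simp: is_path_iff_successively successively_append_iff hd_append split: if_splits)
    then show ?thesis by blast
  next
    case False
    with xs step(2) have "is_path adj (xs @ [z]) \<and> hd (xs @ [z]) = x \<and> last (xs @ [z]) = z"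
      by (auto simp: is_path_iff_successively successively_append_iff)
    then show ?thesis by blast
  qed
qed

text \<open>Two paths that leave a common vertex towards different neighbours and meet again close up
  to a cycle at the first point of the one that lies on the other.\<close>

lemma path_unique:
  assumes "is_path adj xs" "is_path adj ys" "hd xs = hd ys" "last xs = last ys"
  shows "xs = ys"
  using assms
proof (induction xs arbitrary: ys)
  case Nil
  then show ?case by (simp add: is_path_iff_successively)
next
  case (Cons a xs)
  then obtain ys' where ys: "ys = a # ys'"
    by (cases ys) (auto simp: is_path_iff_successively)
  note P = Cons.prems[unfolded ys is_path_iff_successively]
  show ?case
  proof (cases "xs = [] \<or> ys' = []")
    case True
    with P show ?thesis
      by (auto simp: ys split: if_splits dest: last_in_set[of xs] last_in_set[of ys'])
  next
    case False
    then have ne: "xs \<noteq> []" "ys' \<noteq> []" by auto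
    have px: "is_path adj xs" "adj a (hd xs)" and py: "is_path adj ys'" "adj a (hd ys')"
      and an: "a \<notin> set xs" "a \<notin> set ys'" and l: "last xs = last ys'"
      using P ne by (auto simp: is_path_iff_successively successively_Cons)
    show ?thesis
    proof (cases "hd xs = hd ys'")
      case True
      then show ?thesis using Cons.IH[OF px(1) py(1)] l ys by simp
    next
      case hn: False
      have "\<exists>c\<in>set xs. c \<in> set ys'" using l ne by (metis last_in_set)
      then obtain p c p' where c: "xs = p @ c # p'" "c \<in> set ys'" "\<forall>z\<in>set p. z \<notin> set ys'"
        using split_list_first_prop[of xs "\<lambda>c. c \<in> set ys'"] by blast
      then obtain q q' where q: "ys' = q @ c # q'" by (meson split_list)
      have rq: "successively adj (rev q)"
      proof -
        have "successively (\<lambda>x y. adj y x) q"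
          using py(1) q adj_sym
          by (auto simp: is_path_iff_successively successively_append_iff
              intro: successively_mono[of adj])
        then show ?thesis by simp
      qed
      let ?C = "a # p @ [c] @ rev q"
      have "is_path adj ?C"
        using px py c q an rq adj_sym
        by (auto simp: is_path_iff_successively successively_append_iff successively_Cons
            hd_append last_rev hd_rev split: if_splits)
      moreover have "length ?C \<ge> 3"
      proof -
        have "p \<noteq> [] \<or> q \<noteq> []" using hn c q by auto
        then show ?thesis by (cases p; cases q) auto
      qed
      moreover have "adj (last ?C) (hd ?C)"
        using py(2) q adj_sym by (cases q) (auto simp: last_rev)
      ultimately show ?thesis using no_cycle by blast
    qed
  qed
qed

lemma geo_list_path:
  "is_path adj (geo_list adj x y)" "hd (geo_list adj x y) = x" "last (geo_list adj x y) = y"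
proof -
  have "\<exists>!xs. is_path adj xs \<and> hd xs = x \<and> last xs = y"
    using path_exists[of x y] path_unique by metis
  from theI'[OF this] show "is_path adj (geo_list adj x y)" "hd (geo_list adj x y) = x" "last (geo_list adj x y) = y"
    unfolding geo_list_def by blast+
qed

lemma geo_list_eqI:
  "is_path adj xs \<Longrightarrow> hd xs = x \<Longrightarrow> last xs = y \<Longrightarrow> geo_list adj x y = xs"
  using path_unique geo_list_path by metis

lemma geo_eq_set: "geo adj x y = set (geo_list adj x y)"
  using geo_list_eqI geo_list_path[of x y] by (fastforce simp: geo_def)

section \<open>Geodesics from the root, predecessors and children\<close>

lemma gl_ne: "gl x \<noteq> []" and gl_dist: "distinct (gl x)"
  using geo_list_path[of rt x] by (auto simp: is_path_iff_successively)

lemma gl_last: "last (gl x) = x" by (rule geo_list_path)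

lemma gl_self: "x \<in> set (gl x)"
  using gl_last[of x] gl_ne[of x] last_in_set by metis

lemma rt_gl: "rt \<in> set (gl x)"
  using geo_list_path(2)[of rt x] gl_ne[of x] by (metis hd_in_set)

lemma gl_rt: "gl rt = [rt]"
  by (rule geo_list_eqI) (auto simp: is_path_iff_successively)

lemma gl_inj: "gl x = gl y \<Longrightarrow> x = y"
  using gl_last by metis

text \<open>Turns the ancestor order into the prefix order of lists; predecessors, transitivity and
  comparability are read off from it.\<close>

lemma gl_prefix:
  assumes "gl x = as @ z # bs" shows "gl z = as @ [z]"
proof (rule geo_list_eqI)
  show "is_path adj (as @ [z])" "last (as @ [z]) = z"
    using geo_list_path(1)[of rt x] assms
    by (auto simp: is_path_iff_successively successively_append_iff)
  show "hd (as @ [z]) = rt"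
    using geo_list_path(2)[of rt x] assms by (cases as) auto
qed

text \<open>If y lies on the geodesic to x, the stretch from y to x and the edge close up to a cycle
  unless that stretch is the edge itself.\<close>

lemma adj_gl:
  assumes "adj x y" shows "gl y = gl x @ [y] \<or> gl x = gl y @ [x]"
proof (cases "y \<in> set (gl x)")
  case False
  then have "gl y = gl x @ [y]"
    using assms geo_list_path[of rt x] gl_ne[of x]
    by (intro geo_list_eqI) (auto simp: is_path_iff_successively successively_append_iff)
  then show ?thesis ..
next
  case True
  then obtain as bs where gx: "gl x = as @ y # bs" by (meson split_list)
  have gy: "gl y = as @ [y]" using gl_prefix[OF gx] .
  have pb: "is_path adj (y # bs)"
    using geo_list_path(1)[of rt x] gx by (auto simp: is_path_iff_successively successively_append_iff)
  have lb: "last (y # bs) = x" using gl_last[of x] gx by simp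
  have "\<not> length (y # bs) \<ge> 3" using no_cycle[OF pb] lb assms by auto
  moreover have "bs \<noteq> []" using lb assms adj_irrefl by auto
  ultimately have "bs = [x]" using lb by (cases bs; cases "tl bs") auto
  then show ?thesis using gx gy by simp
qed

lemma par_eqI:
  assumes "gl y = gl x @ [y]" shows "par y = x" "adj x y" "adj y x" "y \<noteq> rt"
proof -
  have *: "adj x y"
    using geo_list_path(1)[of rt y] gl_ne[of x] gl_last[of x] assms
    by (auto simp: is_path_iff_successively successively_append_iff)
  then show "adj x y" "adj y x" using adj_sym by auto
  show "y \<noteq> rt" using assms gl_rt gl_ne[of x] by auto
  show "par y = x"
    unfolding pred_def geo_eq_set
  proof (rule the_equality)
    show "adj y x \<and> x \<in> set (gl y)" using * adj_sym gl_self[of x] assms by auto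
    fix z assume z: "adj y z \<and> z \<in> set (gl y)"
    then have "gl z = gl y @ [z] \<or> gl y = gl z @ [y]" using adj_gl by blast
    then show "z = x"
    proof
      assume "gl z = gl y @ [z]"
      then show ?thesis using z gl_dist[of z] by auto
    next
      assume "gl y = gl z @ [y]"
      then show ?thesis using assms gl_inj by auto
    qed
  qed
qed

lemma gl_par:
  assumes "x \<noteq> rt" shows "gl x = gl (par x) @ [x]"
proof -
  have "gl x = butlast (gl x) @ [x]" using gl_ne[of x] gl_last[of x] by (metis append_butlast_last_id)
  moreover have "butlast (gl x) \<noteq> []"
    using geo_list_path(2)[of rt x] assms calculation by (metis append_Nil list.sel(1))
  ultimately obtain as z where "gl x = as @ z # [x]"
    by (metis append.assoc append_Cons append_Nil rev_exhaust)
  with gl_prefix[of x as z] have "gl x = gl z @ [x]" by simp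
  with par_eqI(1)[OF this] show ?thesis by simp
qed

lemma adj_par: "x \<noteq> rt \<Longrightarrow> adj x (par x)" "x \<noteq> rt \<Longrightarrow> adj (par x) x"
  using par_eqI(2,3)[OF gl_par] by blast+

lemma ch_iff: "y \<in> ch x \<longleftrightarrow> gl y = gl x @ [y]"
proof
  assume "y \<in> ch x"
  then have "y \<noteq> rt" "par y = x" by (auto simp: children_def)
  then show "gl y = gl x @ [y]" using gl_par[of y] by simp
next
  assume "gl y = gl x @ [y]"
  from par_eqI[OF this] show "y \<in> ch x" by (simp add: children_def)
qed

lemma ch_par: "y \<in> ch x \<Longrightarrow> par y = x" "y \<in> ch x \<Longrightarrow> y \<noteq> rt" "x \<noteq> rt \<Longrightarrow> x \<in> ch (par x)"
  by (auto simp: children_def)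

lemma ch_adj: "y \<in> ch x \<Longrightarrow> adj x y" "y \<in> ch x \<Longrightarrow> adj y x"
  unfolding ch_iff by (rule par_eqI; assumption)+

lemma length_gl_ch: "y \<in> ch x \<Longrightarrow> length (gl y) = Suc (length (gl x))"
  by (simp add: ch_iff)

lemma nbrs_eq: "{y. adj x y} = ch x \<union> (if x = rt then {} else {par x})"
proof (rule set_eqI)
  fix y
  have "adj x y \<Longrightarrow> y \<in> ch x \<or> (x \<noteq> rt \<and> y = par x)"
    using adj_gl[of x y] par_eqI(1,4)[of x y] unfolding ch_iff by blast
  then show "y \<in> {y. adj x y} \<longleftrightarrow> y \<in> ch x \<union> (if x = rt then {} else {par x})"
    using ch_adj(1)[of y x] adj_par(1)[of x] by auto
qed

lemma par_notin_ch: "x \<noteq> rt \<Longrightarrow> par x \<notin> ch x"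
  using length_gl_ch[of "par x" x] length_gl_ch[OF ch_par(3), of x] by fastforce

section \<open>Subtrees and the ancestor order\<close>

lemma subT_iff: "w \<in> subT adj rt x \<longleftrightarrow> x \<in> set (gl w)"
  by (simp add: subT_def geo_eq_set)

lemma set_gl_par:
  assumes "x \<noteq> rt" shows "set (gl x) = insert x (set (gl (par x)))" "x \<notin> set (gl (par x))"
proof -
  have "distinct (gl (par x) @ [x])" using gl_dist[of x] unfolding gl_par[OF assms] .
  then show "x \<notin> set (gl (par x))" by simp
  show "set (gl x) = insert x (set (gl (par x)))" by (subst gl_par[OF assms]) simp
qed

lemma gl_trans: assumes "x \<in> set (gl y)" "y \<in> set (gl z)" shows "x \<in> set (gl z)"
proof -
  obtain as bs where a: "gl z = as @ y # bs" using assms by (meson split_list)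
  from gl_prefix[OF a] a assms(1) show ?thesis by auto
qed

lemma par_induct [case_names rt par]:
  assumes "P rt" "\<And>x. x \<noteq> rt \<Longrightarrow> P (par x) \<Longrightarrow> P x" shows "P x"
proof (induction "length (gl x)" arbitrary: x rule: less_induct)
  case less
  show ?case
  proof (cases "x = rt")
    case False
    then have "length (gl (par x)) < length (gl x)" using length_gl_ch[OF ch_par(3), of x] by simp
    with less assms(2) False show ?thesis by blast
  qed (use assms in simp)
qed

text \<open>Supplies the separating sets for the Green function: the edge between x and
  \<open>par x\<close> is the only one that crosses the border of the subtree.\<close>

lemma subT_nbr:
  assumes "z \<in> subT adj rt x" "adj z z'" shows "z' \<in> subT adj rt x \<or> (z = x \<and> x \<noteq> rt \<and> z' = par x)"
  using adj_gl[OF assms(2)]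
proof
  assume "gl z' = gl z @ [z']"
  with assms(1) show ?thesis by (simp add: subT_iff)
next
  assume g: "gl z = gl z' @ [z]"
  with assms(1) have "x \<in> set (gl z') \<or> x = z" by (auto simp: subT_iff)
  with par_eqI[OF g] show ?thesis by (auto simp: subT_iff)
qed

lemma not_subT_nbr:
  assumes "z \<notin> subT adj rt x" "adj z z'" shows "z' \<notin> subT adj rt x \<or> (z' = x \<and> z = par x)"
  using subT_nbr[of z' x z] assms adj_sym by blast

lemma par_notin_subT: "x \<noteq> rt \<Longrightarrow> par x \<notin> subT adj rt x"
  using set_gl_par(2)[of x] by (simp add: subT_iff)

text \<open>Both geodesics are prefixes of the one to w, and prefixes of equal length
  coincide.\<close>

lemma gl_same_length:
  assumes "x \<in> set (gl w)" "y \<in> set (gl w)" "length (gl x) = length (gl y)" shows "x = y"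
proof -
  obtain as bs where a: "gl w = as @ x # bs" using assms by (meson split_list)
  obtain cs ds where c: "gl w = cs @ y # ds" using assms by (meson split_list)
  have "length as = length cs" using gl_prefix[OF a] gl_prefix[OF c] assms(3) by simp
  then show ?thesis using a c by simp
qed

lemma comparable:
  assumes "x \<in> set (gl w)" "y \<in> set (gl w)" shows "x \<in> set (gl y) \<or> y \<in> set (gl x)"
proof -
  obtain as bs where a: "gl w = as @ x # bs" using assms by (meson split_list)
  then have "y \<in> set (as @ [x]) \<or> y \<in> set bs" using assms by auto
  then show ?thesis
  proof
    assume "y \<in> set (as @ [x])" then show ?thesis using gl_prefix[OF a] by simp
  next
    assume "y \<in> set bs"
    then obtain cs ds where "bs = cs @ y # ds" by (meson split_list)
    with a have "gl w = (as @ x # cs) @ y # ds" by simp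
    from gl_prefix[OF this] show ?thesis by simp
  qed
qed

lemma gl_length_le: "x \<in> set (gl y) \<Longrightarrow> length (gl x) \<le> length (gl y)"
proof -
  assume "x \<in> set (gl y)"
  then obtain as bs where a: "gl y = as @ x # bs" by (meson split_list)
  from gl_prefix[OF a] a show ?thesis by simp
qed

lemma tdist_eq: "tdist adj rt x = length (gl x) - 1"
  by (simp add: tdist_def)

end

section \<open>Boundary and integral\<close>

locale leafless_tree = rooted_tree +
  assumes ch_ne: "children adj rt x \<noteq> {}"
begin

lemma bd_mono: "x \<in> set (gl y) \<Longrightarrow> bd y \<subseteq> bd x"
  unfolding bdT_def subT_iff using gl_trans by blast

lemma bd_ch: "y \<in> ch x \<Longrightarrow> bd y \<subseteq> bd x"
  using bd_mono[of x y] gl_self[of x] ch_iff[of y x] by simp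

lemma bd_par: "x \<noteq> rt \<Longrightarrow> bd x \<subseteq> bd (par x)"
  using bd_ch ch_par by blast

text \<open>Leaflessness enters here: children can be chosen forever, and the growing distance from
  the root makes the resulting ray injective.\<close>

lemma bd_ne: "bd x \<noteq> {}"
proof -
  define r where "r = rec_nat x (\<lambda>_ z. SOME y. y \<in> ch z)"
  have r0: "r 0 = x" by (simp add: r_def)
  have rS: "r (Suc n) \<in> ch (r n)" for n
    using ch_ne[of "r n"] by (simp add: r_def some_in_eq)
  have len: "length (gl (r n)) = length (gl x) + n" for n
    by (induction n) (simp_all add: r0 length_gl_ch[OF rS])
  have "inj r"
    using len by (intro injI) (metis add_left_cancel)
  then have ray: "geo_ray adj r"
    using rS ch_adj by (auto simp: geo_ray_def)
  have sub: "r n \<in> subT adj rt x" for n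
  proof (induction n)
    case 0 then show ?case by (simp add: subT_iff r0 gl_self)
  next
    case (Suc n) then show ?case using rS[of n] ch_iff[of "r (Suc n)" "r n"] by (simp add: subT_iff)
  qed
  have "{r'. geo_ray adj r' \<and> ray_equiv r r'} \<in> bd x"
    unfolding bdT_def ends_def using ray sub by (auto simp: ray_equiv_def)
  then show ?thesis by blast
qed

text \<open>Representatives of one end agree up to a shift of indices, so they share a vertex, and
  this vertex lies below both x and y.\<close>

lemma bd_common:
  assumes "\<xi> \<in> bd x" "\<xi> \<in> bd y" shows "\<exists>w. x \<in> set (gl w) \<and> y \<in> set (gl w)"
proof -
  obtain r where r: "\<xi> = {r'. geo_ray adj r' \<and> ray_equiv r r'}"
    using assms unfolding bdT_def ends_def by blast
  obtain a b where a: "ray_equiv r a" "\<forall>n. x \<in> set (gl (a n))"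
    and b: "ray_equiv r b" "\<forall>n. y \<in> set (gl (b n))"
    using assms unfolding bdT_def subT_iff r by blast
  obtain i j where ij: "\<forall>n. r (n + i) = a (n + j)" using a unfolding ray_equiv_def by blast
  obtain k l where kl: "\<forall>n. r (n + k) = b (n + l)" using b unfolding ray_equiv_def by blast
  \<comment> \<open>Both sides are \<open>r (i + k)\<close>.\<close>
  have "a (k + j) = b (i + l)" using ij kl by (metis add.commute)
  then show ?thesis using a b by metis
qed

lemma bd_ch_disjoint:
  assumes "y \<in> ch x" "z \<in> ch x" "y \<noteq> z" shows "bd y \<inter> bd z = {}"
proof (rule ccontr)
  assume "bd y \<inter> bd z \<noteq> {}"
  then obtain w where "y \<in> set (gl w)" "z \<in> set (gl w)" using bd_common by blast
  with assms length_gl_ch gl_same_length show False by metis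
qed

text \<open>A vertex with a single child has the same boundary set as that child, so \<open>x \<mapsto> \<partial>T\<^sub>x\<close> need not be
  injective; an additive function of \<open>x\<close> nevertheless depends only on \<open>\<partial>T\<^sub>x\<close>.\<close>

lemma bd_eq_imp_eq:
  assumes nu: "\<And>x. f x = (\<Sum>\<^sub>\<infinity>y\<in>ch x. f y)" and eq: "bd x = bd y"
  shows "(f x :: complex) = f y"
proof -
  have *: "bd x = bd y \<Longrightarrow> f x = f y" if "x \<in> set (gl y)" for x y
    using that
  proof (induction y rule: par_induct)
    case rt
    then show ?case by (simp add: gl_rt)
  next
    case (par y)
    show ?case
    proof (cases "x = y")
      case False
      then have x: "x \<in> set (gl (par y))" using par set_gl_par by auto
      have e: "bd (par y) = bd y" using par.prems bd_par[OF par.hyps] bd_mono[OF x] by blast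
      have "ch (par y) = {y}"
      proof -
        have "z = y" if "z \<in> ch (par y)" for z
          using bd_ch_disjoint[OF that ch_par(3)[OF par.hyps]] bd_ch[OF that] bd_ne[of z] e by blast
        then show ?thesis using ch_par(3)[OF par.hyps] by blast
      qed
      then have "f (par y) = f y" using nu[of "par y"] by simp
      then show ?thesis using par.IH[OF _ x] par.prems e by simp
    qed simp
  qed
  obtain \<xi> where "\<xi> \<in> bd x" using bd_ne by blast
  then obtain w where "x \<in> set (gl w)" "y \<in> set (gl w)" using bd_common eq by blast
  then show ?thesis using comparable * eq by metis
qed

section \<open>Representations of a locally constant function and independence of the tree\<close>

definition lc_sum :: "((nat \<Rightarrow> 'a) set set \<Rightarrow> complex) \<Rightarrow> 'a set \<Rightarrow> ('a \<Rightarrow> complex) \<Rightarrow> complex" where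
  "lc_sum \<nu> \<tau> c = (\<Sum>x\<in>\<tau>. c x * (\<nu> (bd x) - (\<Sum>y\<in>\<tau> \<inter> ch x. \<nu> (bd y))))"

definition lc_rep :: "((nat \<Rightarrow> 'a) set \<Rightarrow> complex) \<Rightarrow> 'a set \<Rightarrow> ('a \<Rightarrow> complex) \<Rightarrow> bool" where
  "lc_rep \<phi> \<tau> c \<longleftrightarrow> finite_rooted_subtree adj rt \<tau> \<and> (\<forall>x\<in>\<tau>. \<forall>\<xi>\<in>piece adj rt \<tau> x. \<phi> \<xi> = c x)"

lemma finite_rooted_subtree_upward:
  assumes "finite_rooted_subtree adj rt \<tau>" "x \<in> \<tau>" shows "set (gl x) \<subseteq> \<tau>"
  using assms(2)
proof (induction x rule: par_induct)
  case rt then show ?case by (simp add: gl_rt)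
next
  case (par x)
  then show ?case using assms set_gl_par(1)[OF par.hyps] unfolding finite_rooted_subtree_def by auto
qed

text \<open>The new vertex inherits the value of its predecessor. Its mass is taken out of the piece
  of the predecessor and counted in its own piece with the same factor, which leaves the sum
  unchanged.\<close>

lemma lc_rep_insert:
  assumes R: "lc_rep \<phi> \<tau> c" and v: "v \<notin> \<tau>" "v \<noteq> rt" "par v \<in> \<tau>"
  shows "lc_rep \<phi> (insert v \<tau>) (c(v := c (par v)))"
    and "lc_sum \<nu> (insert v \<tau>) (c(v := c (par v))) = lc_sum \<nu> \<tau> c"
proof -
  have fin: "finite \<tau>" and fr: "finite_rooted_subtree adj rt \<tau>"
    using R by (auto simp: lc_rep_def finite_rooted_subtree_def)
  have vch: "ch v \<inter> insert v \<tau> = {}"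
  proof -
    have "y \<notin> \<tau>" if "y \<in> ch v" for y
      using that fr v(1) ch_par unfolding finite_rooted_subtree_def by metis
    moreover have "v \<notin> ch v" using length_gl_ch[of v v] by auto
    ultimately show ?thesis by auto
  qed
  have pv: "v \<in> ch (par v)" using v ch_par by blast
  have ins: "insert v \<tau> \<inter> ch x = (if x = par v then insert v (\<tau> \<inter> ch x) else \<tau> \<inter> ch x)" for x
  proof -
    have "v \<in> ch x \<longleftrightarrow> x = par v" using pv ch_par(1) by blast
    then show ?thesis by auto
  qed
  have f2: "finite_rooted_subtree adj rt (insert v \<tau>)"
    using fr v unfolding finite_rooted_subtree_def by auto
  have bv: "piece adj rt (insert v \<tau>) v \<subseteq> piece adj rt \<tau> (par v)"
    using bd_ch_disjoint[OF pv] bd_par[OF v(2)] v(1) unfolding piece_def by blast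
  have "\<phi> \<xi> = (c(v := c (par v))) x"
    if x: "x \<in> insert v \<tau>" and xi: "\<xi> \<in> piece adj rt (insert v \<tau>) x" for x \<xi>
  proof (cases "x = v")
    case True
    then show ?thesis using bv xi R v unfolding lc_rep_def by auto
  next
    case False
    have "piece adj rt (insert v \<tau>) x \<subseteq> piece adj rt \<tau> x" unfolding piece_def by blast
    then show ?thesis using False x xi R unfolding lc_rep_def by auto
  qed
  with f2 show "lc_rep \<phi> (insert v \<tau>) (c(v := c (par v)))" unfolding lc_rep_def by blast
  let ?c = "c(v := c (par v))"
  have "lc_sum \<nu> (insert v \<tau>) ?c
      = c (par v) * \<nu> (bd v) + (\<Sum>x\<in>\<tau>. ?c x * (\<nu> (bd x) - (\<Sum>y\<in>insert v \<tau> \<inter> ch x. \<nu> (bd y))))"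
    unfolding lc_sum_def using fin v(1) vch by (simp add: Int_commute)
  also have "(\<Sum>x\<in>\<tau>. ?c x * (\<nu> (bd x) - (\<Sum>y\<in>insert v \<tau> \<inter> ch x. \<nu> (bd y))))
     = (\<Sum>x\<in>\<tau>. c x * (\<nu> (bd x) - (\<Sum>y\<in>\<tau> \<inter> ch x. \<nu> (bd y))) - (if x = par v then c x * \<nu> (bd v) else 0))"
    using v(1) fin by (intro sum.cong refl) (auto simp: ins algebra_simps)
  also have "\<dots> = lc_sum \<nu> \<tau> c - c (par v) * \<nu> (bd v)"
    using fin v(3) by (simp add: sum_subtractf lc_sum_def)
  finally show "lc_sum \<nu> (insert v \<tau>) ?c = lc_sum \<nu> \<tau> c" by (simp add: fun_upd_def)
qed

lemma lc_rep_extend: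
  assumes "lc_rep \<phi> \<tau> c" "finite_rooted_subtree adj rt \<sigma>" "\<tau> \<subseteq> \<sigma>"
  shows "\<exists>c'. lc_rep \<phi> \<sigma> c' \<and> lc_sum \<nu> \<sigma> c' = lc_sum \<nu> \<tau> c"
  using assms
proof (induction "card (\<sigma> - \<tau>)" arbitrary: \<tau> c)
  case 0
  then have "\<sigma> = \<tau>" by (auto simp: finite_rooted_subtree_def)
  with 0 show ?case by blast
next
  case (Suc n)
  then obtain w where w: "w \<in> \<sigma>" "w \<notin> \<tau>" by (metis Diff_iff card.empty ex_in_conv nat.distinct(1))
  have rt: "rt \<in> \<tau>" using Suc.prems by (auto simp: lc_rep_def finite_rooted_subtree_def)
  \<comment> \<open>The vertex at which the geodesic to w leaves \<tau>: its insertion keeps the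
    tree closed under predecessors.\<close>
  have "\<exists>v\<in>set (gl w). v \<notin> \<tau> \<and> v \<noteq> rt \<and> par v \<in> \<tau>"
    using w(2)
  proof (induction w rule: par_induct)
    case rt with \<open>rt \<in> \<tau>\<close> show ?case by simp
  next
    case (par x)
    then show ?case using set_gl_par(1)[OF par.hyps] by (cases "par x \<in> \<tau>") auto
  qed
  then obtain v where v: "v \<in> set (gl w)" "v \<notin> \<tau>" "v \<noteq> rt" "par v \<in> \<tau>" by blast
  have vs: "v \<in> \<sigma>" using finite_rooted_subtree_upward[OF Suc.prems(2) w(1)] v(1) by blast
  have "n = card (\<sigma> - insert v \<tau>)"
  proof -
    have "finite (\<sigma> - \<tau>)" using Suc.prems by (auto simp: finite_rooted_subtree_def)
    then have "card (\<sigma> - \<tau> - {v}) = n" using vs v(2) Suc.hyps(2) by simp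
    then show ?thesis by (metis Diff_insert)
  qed
  from Suc.hyps(1)[OF this lc_rep_insert(1)[OF Suc.prems(1) v(2,3,4)] Suc.prems(2)]
  show ?case using lc_rep_insert(2)[OF Suc.prems(1) v(2,3,4)] vs Suc.prems(3) by auto
qed

text \<open>On an empty piece the value of the function is arbitrary, but there the tree \<open>\<tau>\<close> contains
  all children, so that the mass of the piece vanishes.\<close>

lemma lc_sum_cong:
  assumes "lc_rep \<phi> \<tau> c" "lc_rep \<phi> \<tau> c'" "complex_distribution adj rt \<nu>"
  shows "lc_sum \<nu> \<tau> c = lc_sum \<nu> \<tau> c'"
  unfolding lc_sum_def
proof (rule sum.cong[OF refl])
  fix x assume x: "x \<in> \<tau>"
  show "c x * (\<nu> (bd x) - (\<Sum>y\<in>\<tau> \<inter> ch x. \<nu> (bd y))) = c' x * (\<nu> (bd x) - (\<Sum>y\<in>\<tau> \<inter> ch x. \<nu> (bd y)))"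
  proof (cases "piece adj rt \<tau> x = {}")
    case False
    then obtain \<xi> where "\<xi> \<in> piece adj rt \<tau> x" by blast
    then have "c x = c' x" using assms(1,2) x unfolding lc_rep_def by metis
    then show ?thesis by simp
  next
    case True
    have "z \<in> \<tau>" if z: "z \<in> ch x" for z
    proof (rule ccontr)
      assume "z \<notin> \<tau>"
      then have "bd z \<subseteq> piece adj rt \<tau> x"
        unfolding piece_def using bd_ch[OF z] bd_ch_disjoint[OF z] by blast
      with True bd_ne[of z] show False by blast
    qed
    then have sub: "\<tau> \<inter> ch x = ch x" by blast
    then have "finite (ch x)" using assms(1) unfolding lc_rep_def finite_rooted_subtree_def
      by (metis finite_Int)
    moreover have "\<nu> (bd x) = (\<Sum>\<^sub>\<infinity>y\<in>ch x. \<nu> (bd y))"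
      using assms(3) unfolding complex_distribution_def by blast
    ultimately have "\<nu> (bd x) = (\<Sum>y\<in>ch x. \<nu> (bd y))" by simp
    with sub show ?thesis by simp
  qed
qed

text \<open>Two representations are compared on the union of their trees, so the \<open>SOME\<close>
  in the definition has only one candidate.\<close>

lemma lc_integral_eq:
  assumes nu: "complex_distribution adj rt \<nu>" and R: "lc_rep \<phi> \<tau> c"
  shows "lc_integral adj rt \<nu> \<phi> = lc_sum \<nu> \<tau> c"
proof -
  have uniq: "lc_sum \<nu> \<tau>' c' = lc_sum \<nu> \<tau> c" if R': "lc_rep \<phi> \<tau>' c'" for \<tau>' c'
  proof -
    have F: "finite_rooted_subtree adj rt (\<tau> \<union> \<tau>')"
      using R R' by (auto simp: lc_rep_def finite_rooted_subtree_def)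
    obtain d where d: "lc_rep \<phi> (\<tau> \<union> \<tau>') d" "lc_sum \<nu> (\<tau> \<union> \<tau>') d = lc_sum \<nu> \<tau> c"
      using lc_rep_extend[OF R F] by blast
    obtain d' where d': "lc_rep \<phi> (\<tau> \<union> \<tau>') d'" "lc_sum \<nu> (\<tau> \<union> \<tau>') d' = lc_sum \<nu> \<tau>' c'"
      using lc_rep_extend[OF R' F] by blast
    show ?thesis using lc_sum_cong[OF d(1) d'(1) nu] d d' by simp
  qed
  have eq: "lc_integral adj rt \<nu> \<phi> = (SOME I. \<exists>\<tau> c. lc_rep \<phi> \<tau> c \<and> I = lc_sum \<nu> \<tau> c)"
    unfolding lc_integral_def lc_rep_def lc_sum_def by (simp add: conj_assoc)
  show ?thesis unfolding eq
    by (rule some_equality) (use R uniq in blast)+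
qed

text \<open>The vertices of \<pi>(o,x) with \<xi> in their boundary set form an initial segment, so
  the last one is recognised by a test at its children. The premises say that \<xi> lies in the
  \<open>piece\<close> of z for the tree \<pi>(o,x).\<close>

lemma meet_end_eqI:
  assumes "z \<in> set (gl x)" "\<xi> \<in> bd z" "\<And>y. y \<in> ch z \<Longrightarrow> y \<in> set (gl x) \<Longrightarrow> \<xi> \<notin> bd y"
  shows "meet_end adj rt x \<xi> = z"
proof -
  have below: "z' \<in> set (gl z)" if z': "z' \<in> set (gl x)" "\<xi> \<in> bd z'" for z'
  proof (rule ccontr)
    assume n: "z' \<notin> set (gl z)"
    then have "z \<in> set (gl z')" using comparable[OF z'(1) assms(1)] by blast
    then have "\<exists>y\<in>ch z. y \<in> set (gl z')" using n
    proof (induction z' rule: par_induct)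
      case rt
      then show ?case by (simp add: rt_gl)
    next
      case (par w)
      show ?case
      proof (cases "par w = z")
        case True
        then show ?thesis using ch_par(3)[OF par.hyps] gl_self by blast
      next
        case False
        have zw: "z \<in> set (gl (par w))"
          using par.prems set_gl_par(1)[OF par.hyps] gl_self[of z] by auto
        have "par w \<notin> set (gl z)"
          using False zw gl_same_length[of "par w" "par w" z] gl_length_le gl_self
          by (metis le_antisym)
        then show ?thesis using par.IH[OF zw] set_gl_par(1)[OF par.hyps] by blast
      qed
    qed
    then obtain y where y: "y \<in> ch z" "y \<in> set (gl z')" by blast
    then have "y \<in> set (gl x)" "\<xi> \<in> bd y" using gl_trans[OF y(2) z'(1)] bd_mono[OF y(2)] z'(2) by auto
    with assms(3) y show False by blast
  qed
  show ?thesis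
    unfolding meet_end_def geo_eq_set
  proof (rule the_equality)
    show "z \<in> set (gl x) \<and> \<xi> \<in> bd z \<and>
      (\<forall>z'\<in>set (gl x). \<xi> \<in> bd z' \<longrightarrow> tdist adj rt z' \<le> tdist adj rt z)"
      using assms(1,2) gl_length_le[OF below] by (auto simp: tdist_eq intro: diff_le_mono)
    fix w assume w: "w \<in> set (gl x) \<and> \<xi> \<in> bd w \<and>
      (\<forall>z'\<in>set (gl x). \<xi> \<in> bd z' \<longrightarrow> tdist adj rt z' \<le> tdist adj rt w)"
    then have "tdist adj rt z \<le> tdist adj rt w" using assms(1,2) by blast
    then have "length (gl z) \<le> length (gl w)" using gl_ne[of z] gl_ne[of w]
      by (cases "gl z"; cases "gl w") (auto simp: tdist_eq)
    moreover have "length (gl w) \<le> length (gl z)" using gl_length_le[OF below] w by blast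
    ultimately show "w = z" using gl_same_length w assms(1) by (metis le_antisym)
  qed
qed

lemma finite_rooted_subtree_gl: "finite_rooted_subtree adj rt (set (gl x))"
proof -
  have "z \<in> set (gl x) \<Longrightarrow> z \<noteq> rt \<Longrightarrow> par z \<in> set (gl x)" for z
    using gl_trans[of "par z" z x] set_gl_par(1)[of z] gl_self[of "par z"] by auto
  then show ?thesis by (auto simp: finite_rooted_subtree_def rt_gl)
qed

lemma lc_integral_meet_end:
  assumes "complex_distribution adj rt \<nu>"
  shows "lc_integral adj rt \<nu> (\<lambda>\<xi>. c (meet_end adj rt x \<xi>)) = lc_sum \<nu> (set (gl x)) c"
proof (rule lc_integral_eq[OF assms])
  show "lc_rep (\<lambda>\<xi>. c (meet_end adj rt x \<xi>)) (set (gl x)) c"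
    unfolding lc_rep_def
    by (auto simp: finite_rooted_subtree_gl piece_def intro!: arg_cong[of _ _ c] meet_end_eqI)
qed

lemma lc_sum_gl_rt: "lc_sum \<nu> (set (gl rt)) c = c rt * \<nu> (bd rt)"
proof -
  have "rt \<notin> ch rt" using length_gl_ch[of rt rt] by auto
  then show ?thesis by (simp add: lc_sum_def gl_rt)
qed

text \<open>Lengthening the geodesic by x moves the mass of its boundary set from the coefficient at
  \<open>par x\<close> to the one at x; this drives the recursion for the Poisson integral.\<close>

lemma lc_sum_gl_par:
  assumes "x \<noteq> rt"
  shows "lc_sum \<nu> (set (gl x)) c = lc_sum \<nu> (set (gl (par x))) c + (c x - c (par x)) * \<nu> (bd x)"
proof -
  let ?S = "set (gl (par x))"
  have S: "set (gl x) = insert x ?S" "x \<notin> ?S" using set_gl_par[OF assms] by auto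
  have e1: "insert x ?S \<inter> ch x = {}"
    using gl_length_le[of _ "par x"] length_gl_ch[of _ x] length_gl_ch[OF ch_par(3)[OF assms]] by force
  have e2: "insert x ?S \<inter> ch z = (if z = par x then insert x (?S \<inter> ch z) else ?S \<inter> ch z)" for z
  proof -
    have "x \<in> ch z \<longleftrightarrow> z = par x" using ch_par(1) ch_par(3)[OF assms] by blast
    then show ?thesis by auto
  qed
  have "lc_sum \<nu> (set (gl x)) c
     = c x * \<nu> (bd x) + (\<Sum>z\<in>?S. c z * (\<nu> (bd z) - (\<Sum>y\<in>insert x ?S \<inter> ch z. \<nu> (bd y))))"
    unfolding lc_sum_def S(1) using S(2) e1 by simp
  also have "(\<Sum>z\<in>?S. c z * (\<nu> (bd z) - (\<Sum>y\<in>insert x ?S \<inter> ch z. \<nu> (bd y))))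
     = (\<Sum>z\<in>?S. c z * (\<nu> (bd z) - (\<Sum>y\<in>?S \<inter> ch z. \<nu> (bd y))) - (if z = par x then c z * \<nu> (bd x) else 0))"
    using S(2) by (intro sum.cong refl) (auto simp: e2 algebra_simps)
  also have "\<dots> = lc_sum \<nu> ?S c - c (par x) * \<nu> (bd x)"
    using gl_self[of "par x"] by (simp add: sum_subtractf lc_sum_def)
  finally show ?thesis by (simp add: algebra_simps)
qed

end

section \<open>Green kernels and the integral representation\<close>

text \<open>The last clause is the multiplicativity of the Green function along geodesics: a walk from
  \<open>x \<in> A\<close> can leave \<open>A\<close> only through \<open>w\<close>.\<close>

definition green_kernel ::
  "('v \<Rightarrow> 'v \<Rightarrow> bool) \<Rightarrow> ('v \<Rightarrow> 'v \<Rightarrow> real) \<Rightarrow> complex \<Rightarrow> ('v \<Rightarrow> 'v \<Rightarrow> complex) \<Rightarrow> bool" where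
  "green_kernel adj p lam g \<longleftrightarrow>
     (\<forall>x y. (\<lambda>z. complex_of_real (p x z) * g z y) summable_on UNIV) \<and>
     (\<forall>x y. lam * g x y - (\<Sum>\<^sub>\<infinity>z. complex_of_real (p x z) * g z y) = (if x = y then 1 else 0)) \<and>
     (\<forall>x. g x x \<noteq> 0) \<and>
     (\<forall>A w x y. w \<in> A \<longrightarrow> (\<forall>z z'. z \<in> A \<longrightarrow> z \<noteq> w \<longrightarrow> adj z z' \<longrightarrow> z' \<in> A) \<longrightarrow>
        y \<notin> A - {w} \<longrightarrow> x \<in> A \<longrightarrow> g x y * g w w = g x w * g w y)"

locale tree_walk = rooted_tree adj rt for adj :: "'v \<Rightarrow> 'v \<Rightarrow> bool" and rt +
  fixes p :: "'v \<Rightarrow> 'v \<Rightarrow> real"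
  assumes no_leaf: "\<not> (\<exists>!y. adj x y)"
    and stoch: "stochastic_nn adj p"
begin

lemma p_nonneg: "p x y \<ge> 0" and p_pos_iff: "p x y > 0 \<longleftrightarrow> adj x y" and p_sum: "(p x has_sum 1) UNIV"
  using stoch by (auto simp: stochastic_nn_def)

lemma p_eq_0_iff: "p x y = 0 \<longleftrightarrow> \<not> adj x y"
  using p_nonneg[of x y] p_pos_iff[of x y] by auto

text \<open>An isolated vertex would have a zero row, against row sum 1. With \<open>no_leaf\<close>
  every vertex then has two neighbours, hence a child.\<close>

lemma has_nbr: "\<exists>y. adj x y"
proof (rule ccontr)
  assume "\<not> ?thesis"
  then have "p x = (\<lambda>_. 0)" using p_eq_0_iff by auto
  then show False using p_sum[of x] has_sum_0[of UNIV "\<lambda>_. 0::real"] has_sum_unique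
    by (metis zero_neq_one)
qed

end

sublocale tree_walk \<subseteq> leafless_tree
proof
  fix x
  show "children adj rt x \<noteq> {}"
  proof
    assume "children adj rt x = {}"
    then have "{y. adj x y} \<subseteq> {par x}" using nbrs_eq[of x] by (auto split: if_splits)
    then show False using has_nbr[of x] no_leaf[of x] by blast
  qed
qed

context tree_walk
begin

section \<open>The operator P split into children and predecessor\<close>

lemma summable_nbrs_iff:
  fixes f :: "'v \<Rightarrow> complex"
  shows "(\<lambda>y. complex_of_real (p x y) * f y) summable_on UNIV \<longleftrightarrow>
    (\<lambda>y. complex_of_real (p x y) * f y) summable_on ch x"
proof -
  have "(\<lambda>y. complex_of_real (p x y) * f y) summable_on UNIV \<longleftrightarrow>
    (\<lambda>y. complex_of_real (p x y) * f y) summable_on {y. adj x y}"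
    by (rule summable_on_cong_neutral) (auto simp: p_eq_0_iff)
  also have "\<dots> \<longleftrightarrow> (\<lambda>y. complex_of_real (p x y) * f y) summable_on ch x"
    unfolding nbrs_eq by (simp add: summable_on_insert_iff)
  finally show ?thesis .
qed

lemma infsum_nbrs:
  fixes f :: "'v \<Rightarrow> complex"
  assumes "(\<lambda>y. complex_of_real (p x y) * f y) summable_on UNIV"
  shows "(\<Sum>\<^sub>\<infinity>y. complex_of_real (p x y) * f y) = (\<Sum>\<^sub>\<infinity>y\<in>ch x. complex_of_real (p x y) * f y)
     + (if x = rt then 0 else complex_of_real (p x (par x)) * f (par x))"
proof -
  have "(\<Sum>\<^sub>\<infinity>y. complex_of_real (p x y) * f y) = (\<Sum>\<^sub>\<infinity>y\<in>{y. adj x y}. complex_of_real (p x y) * f y)"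
    by (rule infsum_cong_neutral) (auto simp: p_eq_0_iff)
  also have "\<dots> = (\<Sum>\<^sub>\<infinity>y\<in>ch x. complex_of_real (p x y) * f y)
     + (if x = rt then 0 else complex_of_real (p x (par x)) * f (par x))"
  proof (cases "x = rt")
    case False
    have "(\<lambda>y. complex_of_real (p x y) * f y) summable_on ch x"
      using assms summable_nbrs_iff by blast
    then show ?thesis using False unfolding nbrs_eq by (simp add: infsum_insert par_notin_ch add.commute)
  qed (simp add: nbrs_eq)
  finally show ?thesis .
qed

end

locale green_walk = tree_walk adj rt p for adj :: "'v \<Rightarrow> 'v \<Rightarrow> bool" and rt p +
  fixes lam :: complex
  assumes kernel: "green_kernel adj p lam (Green adj p rt lam)"
begin

abbreviation "g \<equiv> Green adj p rt lam"
abbreviation "F \<equiv> Ffun adj p rt lam"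

section \<open>Separation and the functions F\<close>

lemma g_sum: "(\<lambda>z. complex_of_real (p x z) * g z y) summable_on UNIV"
  and g_eq: "(\<Sum>\<^sub>\<infinity>z. complex_of_real (p x z) * g z y) = lam * g x y - (if x = y then 1 else 0)"
  and g_diag: "g x x \<noteq> 0"
proof -
  have eq: "lam * g x y - (\<Sum>\<^sub>\<infinity>z. complex_of_real (p x z) * g z y) = (if x = y then 1 else 0)"
    using kernel unfolding green_kernel_def by blast
  then show "(\<Sum>\<^sub>\<infinity>z. complex_of_real (p x z) * g z y) = lam * g x y - (if x = y then 1 else 0)"
    unfolding eq[symmetric] by simp
qed (use kernel in \<open>unfold green_kernel_def, blast+\<close>)

lemma g_sep:
  assumes "w \<in> A" "\<And>z z'. z \<in> A \<Longrightarrow> z \<noteq> w \<Longrightarrow> adj z z' \<Longrightarrow> z' \<in> A" "y \<notin> A - {w}" "x \<in> A"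
  shows "g x y * g w w = g x w * g w y"
  using kernel assms unfolding green_kernel_def by blast

text \<open>The separating set is the subtree at x with \<open>par x\<close> added, its only
  exit.\<close>

lemma g_sep_up:
  assumes "x \<noteq> rt" "z \<notin> subT adj rt x" "y \<in> subT adj rt x"
  shows "g y z * g (par x) (par x) = g y (par x) * g (par x) z"
proof (rule g_sep[where A = "insert (par x) (subT adj rt x)"])
  fix v v' assume "v \<in> insert (par x) (subT adj rt x)" "v \<noteq> par x" "adj v v'"
  then show "v' \<in> insert (par x) (subT adj rt x)" using subT_nbr[of v x v'] by auto
qed (use assms in auto)

lemma self_in_subT: "x \<in> subT adj rt x"
  by (simp add: subT_iff gl_self)

text \<open>On the way into the subtree both ends of the connecting edge are cut points: the
  complement is used once with x added and once as it is.\<close>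

lemma g_sep_out:
  assumes "x \<noteq> rt" "z \<notin> subT adj rt x" "y \<in> subT adj rt x"
  shows "g z y * g x x = g z x * g x y" "g z y * g (par x) (par x) = g z (par x) * g (par x) y"
proof -
  show "g z y * g x x = g z x * g x y"
  proof (rule g_sep[where A = "insert x (- subT adj rt x)"])
    fix v v' assume "v \<in> insert x (- subT adj rt x)" "v \<noteq> x" "adj v v'"
    then show "v' \<in> insert x (- subT adj rt x)" using not_subT_nbr[of v x v'] by auto
  qed (use assms in auto)
  show "g z y * g (par x) (par x) = g z (par x) * g (par x) y"
  proof (rule g_sep[where A = "- subT adj rt x"])
    fix v v' assume "v \<in> - subT adj rt x" "v \<noteq> par x" "adj v v'"
    then show "v' \<in> - subT adj rt x" using not_subT_nbr[of v x v'] by auto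
  qed (use assms par_notin_subT in auto)
qed

lemma ch_notin_subT:
  assumes "y \<in> ch x" "z \<in> ch x" "y \<noteq> z" shows "y \<notin> subT adj rt z"
proof
  assume "y \<in> subT adj rt z"
  then have "z \<in> set (gl y)" by (simp add: subT_iff)
  then show False using gl_same_length[of z y y] gl_self[of y] length_gl_ch assms by metis
qed

text \<open>Distinct neighbours of x lie in different components once x is removed. The cases only
  decide which of them may be the predecessor, because the separating sets refer to the
  root.\<close>

lemma g_sep_nbr:
  assumes "adj x y" "adj x z" "y \<noteq> z"
  shows "g z y * g x x = g z x * g x y"
proof (cases "z \<in> ch x")
  case True
  have "y \<notin> subT adj rt z"
  proof (cases "y \<in> ch x")
    case False
    then have "x \<noteq> rt" "y = par x" using assms(1) nbrs_eq[of x] by (auto split: if_splits)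
    then have "length (gl z) > length (gl y)"
      using length_gl_ch[OF True] length_gl_ch[OF ch_par(3)] by simp
    then show ?thesis using gl_length_le[of z y] by (auto simp: subT_iff)
  qed (use ch_notin_subT True assms in blast)
  then show ?thesis using g_sep_up[of z y z] True ch_par(1,2)[of z x] self_in_subT by auto
next
  case False
  then have z: "x \<noteq> rt" "z = par x" using assms(2) nbrs_eq[of x] by (auto split: if_splits)
  then have "y \<in> ch x" using assms nbrs_eq[of x] by (auto split: if_splits)
  then have "y \<in> subT adj rt x" using ch_iff[of y x] gl_self[of x] by (simp add: subT_iff)
  then show ?thesis using g_sep_out(1)[of x z y] z par_notin_subT by auto
qed

text \<open>By separation, column y of G is a fixed multiple of column x at all neighbours of x
  other than y. Hence the resolvent equations at x for these two columns differ, beyond that factor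
  and the unit on the diagonal, in a single summand.\<close>

lemma F_edge:
  assumes "adj x y"
  shows "F x y = complex_of_real (p x y) * g x x * (1 - F x y * F y x)"
proof -
  \<comment> \<open>The denominator is G(x,x), unlike in F(x,y): this is the factor that carries
    column x to column y.\<close>
  define a where "a = g x y / g x x"
  have xy: "x \<noteq> y" using assms adj_irrefl by auto
  let ?d = "\<lambda>z. if z = y then complex_of_real (p x y) * (g y y - g y x * a) else 0"
  have summand: "complex_of_real (p x z) * g z y = complex_of_real (p x z) * g z x * a + ?d z" for z
  proof (cases "z = y \<or> \<not> adj x z")
    case True
    then show ?thesis using p_eq_0_iff[of x z] by (auto simp: algebra_simps)
  next
    case False
    then have "g z y = g z x * a"
      using g_sep_nbr[OF assms, of z] g_diag[of x] by (auto simp: a_def field_simps)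
    then show ?thesis using False by simp
  qed
  have "((\<lambda>z. complex_of_real (p x z) * g z x) has_sum (lam * g x x - 1)) UNIV"
    using has_sum_infsum[OF g_sum[of x x]] g_eq[of x x] by simp
  then have s1: "((\<lambda>z. complex_of_real (p x z) * g z x * a) has_sum ((lam * g x x - 1) * a)) UNIV"
    by (rule has_sum_cmult_left)
  have "(?d has_sum (\<Sum>z\<in>{y}. ?d z)) {y}" by (rule has_sum_finite) simp
  then have s2: "(?d has_sum ?d y) UNIV"
    by (subst has_sum_cong_neutral[where T = "{y}" and g = ?d]) auto
  have "((\<lambda>z. complex_of_real (p x z) * g z y) has_sum ((lam * g x x - 1) * a + ?d y)) UNIV"
    unfolding summand by (rule has_sum_add[OF s1 s2])
  then have "lam * g x y = (lam * g x x - 1) * a + ?d y"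
    using g_eq[of x y] xy infsumI by fastforce
  moreover have "g x y = g x x * a" using g_diag by (simp add: a_def)
  ultimately have "a = complex_of_real (p x y) * (g y y - g y x * a)" by (simp add: algebra_simps)
  then have e: "g x y = complex_of_real (p x y) * (g x x * g y y - g x y * g y x)"
    using g_diag[of x] by (simp add: a_def field_simps)
  have "F x y = complex_of_real (p x y) * (g x x * g y y - g x y * g y x) / g y y"
    unfolding Ffun_def by (subst e) (rule refl)
  also have "\<dots> = complex_of_real (p x y) * g x x * (1 - F x y * F y x)"
    using g_diag[of x] g_diag[of y] by (simp add: Ffun_def field_simps)
  finally show ?thesis .
qed

text \<open>A zero of F(x,y) would turn \<open>F_edge\<close> into 0 = p(x,y) G(x,x), and a zero of
  the second expression would force F(x,y) = 0.\<close>

lemma F_edge_nz: assumes "adj x y" shows "F x y \<noteq> 0" "1 - F x y * F y x \<noteq> 0"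
proof -
  have "p x y \<noteq> 0" using assms p_eq_0_iff by blast
  then show "F x y \<noteq> 0" using F_edge[OF assms] g_diag[of x] by auto
  then show "1 - F x y * F y x \<noteq> 0" using F_edge[OF assms] by auto
qed

lemma F_self: "F x x = 1" using g_diag by (simp add: Ffun_def)

lemma rt_notin_subT: "x \<noteq> rt \<Longrightarrow> rt \<notin> subT adj rt x"
  by (simp add: subT_iff gl_rt)

lemma F_rt_par:
  assumes "x \<noteq> rt" shows "F rt x = F rt (par x) * F (par x) x"
  using g_sep_out(2)[OF assms rt_notin_subT[OF assms] self_in_subT] g_diag[of "par x"] g_diag[of x]
  by (simp add: Ffun_def field_simps)

lemma F_rt_nz: "F rt x \<noteq> 0"
proof (induction x rule: par_induct)
  case (par x)
  then show ?case using F_rt_par F_edge_nz(1)[OF adj_par(2)] by simp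
qed (simp add: F_self)

section \<open>The integral of the Martin kernel\<close>

lemma lc_sum_cmult: "lc_sum \<nu> \<tau> (\<lambda>z. a * c z) = a * lc_sum \<nu> \<tau> c"
  by (simp add: lc_sum_def sum_distrib_left mult.assoc)

text \<open>The integral as a finite sum along \<pi>(o,x). In this form the recursion is solved for
  any set function; additivity enters with \<open>lc_integral_poisson\<close>, through independence
  of the tree.\<close>

definition poisson :: "((nat \<Rightarrow> 'v) set set \<Rightarrow> complex) \<Rightarrow> 'v \<Rightarrow> complex" where
  "poisson \<nu> x = lc_sum \<nu> (set (gl x)) (\<lambda>z. g x z / g rt z)"

lemma poisson_rt: "poisson \<nu> rt = \<nu> (bd rt)"
  by (simp add: poisson_def lc_sum_gl_rt g_diag)

text \<open>Along the geodesic to \<open>par x\<close> the kernel of x is F(x,par x) times the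
  kernel of \<open>par x\<close>. What remains is the jump of the kernel of x between
  \<open>par x\<close> and x, weighted with the mass at x.\<close>

lemma poisson_par:
  assumes "x \<noteq> rt"
  shows "poisson \<nu> x = F x (par x) * poisson \<nu> (par x)
      + \<nu> (bd x) * (1 - F (par x) x * F x (par x)) / F rt x"
proof -
  have "lc_sum \<nu> (set (gl (par x))) (\<lambda>z. g x z / g rt z)
      = lc_sum \<nu> (set (gl (par x))) (\<lambda>z. F x (par x) * (g (par x) z / g rt z))"
    unfolding lc_sum_def
  proof (rule sum.cong[OF refl])
    fix z assume "z \<in> set (gl (par x))"
    then have "z \<notin> subT adj rt x"
      using gl_length_le[of x z] gl_length_le[of z "par x"] length_gl_ch[OF ch_par(3)[OF assms]]
      by (auto simp: subT_iff)
    then have "g x z = F x (par x) * g (par x) z"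
      using g_sep_up[OF assms _ self_in_subT] g_diag[of "par x"] by (simp add: Ffun_def field_simps)
    then show "g x z / g rt z * (\<nu> (bd z) - (\<Sum>y\<in>set (gl (par x)) \<inter> ch z. \<nu> (bd y))) =
      F x (par x) * (g (par x) z / g rt z) * (\<nu> (bd z) - (\<Sum>y\<in>set (gl (par x)) \<inter> ch z. \<nu> (bd y)))"
      by simp
  qed
  then have "poisson \<nu> x = F x (par x) * poisson \<nu> (par x)
     + (g x x / g rt x - g x (par x) / g rt (par x)) * \<nu> (bd x)"
    unfolding poisson_def lc_sum_gl_par[OF assms] lc_sum_cmult by simp
  moreover have "g x x / g rt x - g x (par x) / g rt (par x) = (1 - F (par x) x * F x (par x)) / F rt x"
  proof -
    have "g x x / g rt x = 1 / F rt x" by (simp add: Ffun_def)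
    moreover have "g x (par x) / g rt (par x) = F x (par x) / F rt (par x)"
      using g_diag[of "par x"] by (simp add: Ffun_def)
    moreover have "F rt (par x) = F rt x / F (par x) x"
      using F_rt_par[OF assms] F_edge_nz(1)[OF adj_par(2)[OF assms]] by simp
    ultimately show ?thesis by (simp add: diff_divide_distrib)
  qed
  ultimately show ?thesis by (simp add: algebra_simps)
qed

lemma lc_integral_poisson:
  "complex_distribution adj rt \<nu> \<Longrightarrow> lc_integral adj rt \<nu> (Kmartin adj p rt lam x) = poisson \<nu> x"
  using lc_integral_meet_end[of \<nu> "\<lambda>z. g x z / g rt z" x] unfolding Kmartin_def[abs_def] poisson_def .

section \<open>The distribution attached to a function\<close>

abbreviation "nu \<equiv> nu_h adj p rt lam"

lemma nu_rt: "nu h rt = h rt" by (simp add: nu_h_def)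

lemma nu_nonrt: "x \<noteq> rt \<Longrightarrow>
  nu h x = F rt x * (h x - F x (par x) * h (par x)) / (1 - F (par x) x * F x (par x))"
  by (simp add: nu_h_def Let_def)

text \<open>Since F(o,x) and 1 - F(par x,x) F(x,par x) do not vanish, each step of the recursion can
  be solved for the mass at x as well as for h(x).\<close>

lemma poisson_iff: "(\<forall>x. h x = poisson \<nu> x) \<longleftrightarrow> (\<forall>x. \<nu> (bd x) = nu h x)"
proof
  assume h: "\<forall>x. h x = poisson \<nu> x"
  show "\<forall>x. \<nu> (bd x) = nu h x"
  proof
    fix x
    show "\<nu> (bd x) = nu h x"
    proof (cases "x = rt")
      case True
      then show ?thesis using h poisson_rt nu_rt by simp
    next
      case False
      have "h x - F x (par x) * h (par x) = \<nu> (bd x) * (1 - F (par x) x * F x (par x)) / F rt x"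
        using h poisson_par[OF False, of \<nu>] by simp
      then show ?thesis
        using F_rt_nz[of x] F_edge_nz(2)[OF adj_par(2)[OF False]] nu_nonrt[OF False] by simp
    qed
  qed
next
  assume n: "\<forall>x. \<nu> (bd x) = nu h x"
  show "\<forall>x. h x = poisson \<nu> x"
  proof
    fix x show "h x = poisson \<nu> x"
    proof (induction x rule: par_induct)
      case rt
      then show ?case using n poisson_rt nu_rt by simp
    next
      case (par x)
      show ?case
        using F_rt_nz[of x] F_edge_nz(2)[OF adj_par(2)[OF par.hyps]]
        by (simp add: poisson_par[OF par.hyps] n nu_nonrt[OF par.hyps] par.IH)
    qed
  qed
qed

text \<open>Writing F(o,y) = F(o,x) F(x,y), the denominator cancels by \<open>F_edge\<close>. What
  is left are the summands of Ph(x) and of PG(.,x) at x.\<close>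

lemma nu_ch:
  assumes "y \<in> ch x"
  shows "nu h y = F rt x * (g x x * (complex_of_real (p x y) * h y) - (complex_of_real (p x y) * g y x) * h x)"
proof -
  have y: "y \<noteq> rt" "par y = x" using ch_par assms by auto
  have a: "adj x y" using ch_adj assms by blast
  have "nu h y = F rt x * (F x y / (1 - F x y * F y x)) * (h y - F y x * h x)"
    using nu_nonrt[OF y(1), of h] F_rt_par[OF y(1)] y(2) by simp
  also have "F x y / (1 - F x y * F y x) = complex_of_real (p x y) * g x x"
    using F_edge[OF a] F_edge_nz(2)[OF a] by (simp add: field_simps)
  finally have "nu h y = F rt x * (complex_of_real (p x y) * g x x) * (h y - F y x * h x)" .
  then show ?thesis using g_diag[of x] by (simp add: Ffun_def field_simps)
qed

text \<open>The summands p(x,y) G(y,x) form a summable family, and the factors F(o,x) and G(x,x) are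
  nonzero, so only p(x,y) h(y) decides.\<close>

lemma nu_summable_iff:
  "nu h summable_on ch x \<longleftrightarrow> (\<lambda>y. complex_of_real (p x y) * h y) summable_on UNIV"
proof -
  let ?f = "\<lambda>y. complex_of_real (p x y) * h y" and ?b = "\<lambda>y. complex_of_real (p x y) * g y x * h x"
  have b: "?b summable_on ch x"
    using g_sum[of x x] summable_nbrs_iff[of x "\<lambda>y. g y x"] by (intro summable_on_cmult_left) blast
  have "nu h summable_on ch x \<longleftrightarrow> (\<lambda>y. F rt x * (g x x * ?f y - ?b y)) summable_on ch x"
    by (rule summable_on_cong) (rule nu_ch)
  also have "\<dots> \<longleftrightarrow> (\<lambda>y. g x x * ?f y - ?b y) summable_on ch x"
    using F_rt_nz[of x] by (simp add: summable_on_cmult_right')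
  also have "\<dots> \<longleftrightarrow> (\<lambda>y. g x x * ?f y) summable_on ch x"
    using summable_on_add[OF _ b, of "\<lambda>y. g x x * ?f y - ?b y"]
      summable_on_add[OF _ iffD2[OF summable_on_uminus b], of "\<lambda>y. g x x * ?f y"]
    by auto
  also have "\<dots> \<longleftrightarrow> ?f summable_on ch x"
    using g_diag[of x] by (simp add: summable_on_cmult_right')
  finally show ?thesis using summable_nbrs_iff by blast
qed

lemma nu_infsum_iff:
  assumes s: "(\<lambda>y. complex_of_real (p x y) * h y) summable_on UNIV"
  shows "nu h x = (\<Sum>\<^sub>\<infinity>y\<in>ch x. nu h y) \<longleftrightarrow> (\<Sum>\<^sub>\<infinity>y. complex_of_real (p x y) * h y) = lam * h x"
proof -
  let ?f = "\<lambda>y. complex_of_real (p x y) * h y" and ?b = "\<lambda>y. complex_of_real (p x y) * g y x"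
  define Ph where "Ph = (\<Sum>\<^sub>\<infinity>y. ?f y)"
  define q where "q = complex_of_real (p x (par x))"
  have f: "?f summable_on ch x" using s summable_nbrs_iff by blast
  have b: "?b summable_on ch x" using g_sum[of x x] summable_nbrs_iff[of x "\<lambda>y. g y x"] by blast
  have "(\<Sum>\<^sub>\<infinity>y\<in>ch x. nu h y) = (\<Sum>\<^sub>\<infinity>y\<in>ch x. F rt x * (g x x * ?f y - ?b y * h x))"
    by (rule infsum_cong) (rule nu_ch)
  also have "\<dots> = F rt x * (\<Sum>\<^sub>\<infinity>y\<in>ch x. g x x * ?f y - ?b y * h x)"
    by (rule infsum_cmult_right')
  also have "(\<Sum>\<^sub>\<infinity>y\<in>ch x. g x x * ?f y - ?b y * h x)
      = g x x * (\<Sum>\<^sub>\<infinity>y\<in>ch x. ?f y) - (\<Sum>\<^sub>\<infinity>y\<in>ch x. ?b y) * h x"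
    using infsum_add[OF summable_on_cmult_right[OF f] iffD2[OF summable_on_uminus summable_on_cmult_left[OF b]]]
    by (simp add: infsum_cmult_right' infsum_cmult_left' infsum_uminus)
  finally have S: "(\<Sum>\<^sub>\<infinity>y\<in>ch x. nu h y) = F rt x * (g x x * (\<Sum>\<^sub>\<infinity>y\<in>ch x. ?f y) - (\<Sum>\<^sub>\<infinity>y\<in>ch x. ?b y) * h x)" .
  have f1: "(\<Sum>\<^sub>\<infinity>y\<in>ch x. ?f y) = Ph - (if x = rt then 0 else q * h (par x))"
    using infsum_nbrs[OF s] by (simp add: Ph_def q_def)
  \<comment> \<open>The 1 is the right-hand side of the resolvent equation on the diagonal; it
    produces the free term h(x) in \<open>nu h x\<close>.\<close>
  have b1: "(\<Sum>\<^sub>\<infinity>y\<in>ch x. ?b y) = lam * g x x - 1 - (if x = rt then 0 else q * g (par x) x)"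
    using infsum_nbrs[OF g_sum[of x x]] g_eq[of x x] by (simp add: q_def algebra_simps)
  have key: "(\<Sum>\<^sub>\<infinity>y\<in>ch x. nu h y) = nu h x + F rt x * g x x * (Ph - lam * h x)"
  proof (cases "x = rt")
    case True
    then show ?thesis unfolding S f1 b1 using nu_rt[of h] F_self[of rt] by (simp add: algebra_simps)
  next
    case False
    have e: "F x (par x) = q * g x x * (1 - F x (par x) * F (par x) x)"
      unfolding q_def by (rule F_edge[OF adj_par(1)[OF False]])
    have nz: "1 - F x (par x) * F (par x) x \<noteq> 0"
      by (rule F_edge_nz(2)[OF adj_par(1)[OF False]])
    have gF: "g (par x) x = F (par x) x * g x x" using g_diag by (simp add: Ffun_def)
    \<comment> \<open>\<open>F_edge\<close> towards the predecessor removes the denominator; the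
      correction to h(x) then consists of exactly the summands at \<open>par x\<close> that the sum
      over children lacks.\<close>
    have "(h x - F x (par x) * h (par x)) / (1 - F x (par x) * F (par x) x)
        = h x - g x x * q * (h (par x) - F (par x) x * h x)"
    proof -
      define u v D where "u = F x (par x)" and "v = F (par x) x" and "D = 1 - u * v"
      have D: "q * g x x * D = u" "D \<noteq> 0" "D + u * v = 1" using e nz by (simp_all add: u_def v_def D_def)
      have "(h x - g x x * q * (h (par x) - v * h x)) * D
          = h x * D - (q * g x x * D) * h (par x) + (q * g x x * D) * v * h x"
        by (simp add: algebra_simps)
      also have "\<dots> = h x * (D + u * v) - u * h (par x)" unfolding D(1) by (simp add: algebra_simps)
      finally have "h x - u * h (par x) = (h x - g x x * q * (h (par x) - v * h x)) * D"
        unfolding D(3) by simp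
      then show ?thesis using D(2) unfolding u_def[symmetric] v_def[symmetric] D_def[symmetric]
        by (simp add: field_simps)
    qed
    then have "nu h x = F rt x * (h x - g x x * q * (h (par x) - F (par x) x * h x))"
      unfolding nu_nonrt[OF False] mult.commute[of "F (par x) x" "F x (par x)"]
        times_divide_eq_right[symmetric] by (rule arg_cong)
    then show ?thesis unfolding S f1 b1 gF using False by (simp add: algebra_simps)
  qed
  show ?thesis unfolding key Ph_def[symmetric] using F_rt_nz[of x] g_diag[of x] by auto
qed

theorem poisson_martin:
  "(is_eigenfun p lam h \<longleftrightarrow>
      (\<exists>\<nu>. complex_distribution adj rt \<nu> \<and> (\<forall>x. h x = lc_integral adj rt \<nu> (Kmartin adj p rt lam x))))
    \<and> (\<forall>\<nu>. complex_distribution adj rt \<nu> \<and> (\<forall>x. h x = lc_integral adj rt \<nu> (Kmartin adj p rt lam x))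
        \<longrightarrow> (\<forall>x. \<nu> (bd x) = nu h x))"
proof -
  have eig: "is_eigenfun p lam h \<longleftrightarrow>
     (\<forall>x. nu h summable_on ch x \<and> nu h x = (\<Sum>\<^sub>\<infinity>y\<in>ch x. nu h y))"
    unfolding is_eigenfun_def nu_summable_iff summable_on_iff_abs_summable_on_complex[symmetric]
    using nu_infsum_iff by (intro all_cong1 conj_cong) auto
  have dist: "complex_distribution adj rt \<nu> \<longleftrightarrow>
     (\<forall>x. (\<lambda>y. \<nu> (bd y)) summable_on ch x \<and> \<nu> (bd x) = (\<Sum>\<^sub>\<infinity>y\<in>ch x. \<nu> (bd y)))" for \<nu>
    unfolding complex_distribution_def summable_on_iff_abs_summable_on_complex[symmetric] ..
  have repr: "complex_distribution adj rt \<nu> \<and> (\<forall>x. h x = lc_integral adj rt \<nu> (Kmartin adj p rt lam x))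
      \<longleftrightarrow> complex_distribution adj rt \<nu> \<and> (\<forall>x. \<nu> (bd x) = nu h x)" for \<nu>
    using lc_integral_poisson[of \<nu>] by (simp add: poisson_iff[symmetric] cong: conj_cong)
  have "\<exists>\<nu>. complex_distribution adj rt \<nu> \<and> (\<forall>x. \<nu> (bd x) = nu h x)" if "is_eigenfun p lam h"
  proof -
    have N: "nu h summable_on ch x" "nu h x = (\<Sum>\<^sub>\<infinity>y\<in>ch x. nu h y)" for x
      using that unfolding eig by blast+
    \<comment> \<open>A function of vertices is moved to boundary sets; by additivity the chosen
      vertex does not matter.\<close>
    define \<nu> where "\<nu> S = nu h (SOME x. bd x = S)" for S
    have nb: "\<nu> (bd x) = nu h x" for x
      unfolding \<nu>_def by (rule bd_eq_imp_eq[OF N(2)]) (rule someI[of "\<lambda>z. bd z = bd x" x, OF refl])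
    then have "complex_distribution adj rt \<nu>" unfolding dist nb using N by blast
    with nb show ?thesis by blast
  qed
  moreover have "is_eigenfun p lam h" if "complex_distribution adj rt \<nu>" "\<forall>x. \<nu> (bd x) = nu h x" for \<nu>
  proof -
    have "(\<lambda>y. \<nu> (bd y)) = nu h" using that(2) by blast
    then show ?thesis using that(1) unfolding dist eig by metis
  qed
  ultimately show ?thesis unfolding repr by blast
qed

end

section \<open>The resolvent\<close>

context tree_walk
begin

section \<open>The reversing measure\<close>

abbreviation "m \<equiv> mmeas adj p rt"
abbreviation "L2 \<equiv> l2m adj p rt"

lemma m_rt: "m rt = 1"
  by (simp add: mmeas_def gl_rt)

lemma m_par:
  assumes "x \<noteq> rt" shows "m x = m (par x) * (p (par x) x / p x (par x))"
proof -
  let ?ys = "gl (par x)"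
  obtain k where k: "length ?ys = Suc k" using gl_ne[of "par x"] by (cases ?ys) auto
  have lastk: "?ys ! k = par x" using gl_last[of "par x"] gl_ne[of "par x"] k by (simp add: last_conv_nth)
  have "m x = (\<Prod>i<Suc k. p ((?ys @ [x]) ! i) ((?ys @ [x]) ! Suc i) / p ((?ys @ [x]) ! Suc i) ((?ys @ [x]) ! i))"
    unfolding mmeas_def Let_def gl_par[OF assms] using k by simp
  also have "\<dots> = (\<Prod>i<k. p (?ys ! i) (?ys ! Suc i) / p (?ys ! Suc i) (?ys ! i)) * (p (par x) x / p x (par x))"
    unfolding prod.lessThan_Suc
    by (rule arg_cong2[where f = "(*)"], rule prod.cong) (auto simp: nth_append k lastk)
  also have "(\<Prod>i<k. p (?ys ! i) (?ys ! Suc i) / p (?ys ! Suc i) (?ys ! i)) = m (par x)"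
    unfolding mmeas_def Let_def k by simp
  finally show ?thesis .
qed

lemma m_pos: "m x > 0"
proof (induction x rule: par_induct)
  case (par x)
  then show ?case using m_par[OF par.hyps] p_pos_iff adj_par[OF par.hyps] by simp
qed (simp add: m_rt)

lemma m_reversible: "m x * p x y = m y * p y x"
proof (cases "adj x y")
  case True
  have *: "m x * p x y = m y * p y x" if "y \<in> ch x" for x y
  proof -
    have "y \<noteq> rt" "par y = x" using ch_par that by auto
    moreover have "p y x \<noteq> 0" using ch_adj[OF that] p_eq_0_iff by blast
    ultimately show ?thesis using m_par[of y] by (simp add: field_simps)
  qed
  have "y \<in> ch x \<or> x \<in> ch y" using adj_gl[OF True] unfolding ch_iff .
  then show ?thesis using *[of y x] *[of x y] by auto
next
  case False
  moreover have "\<not> adj y x" using False adj_sym by blast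
  ultimately show ?thesis using p_eq_0_iff by (metis mult_zero_right)
qed

lemma p_le_1: "p x y \<le> 1"
proof -
  have "((\<lambda>y. p x y) has_sum p x y) {y}" using has_sum_finite[of "{y}" "p x"] by simp
  then show ?thesis using has_sum_mono2[OF _ p_sum[of x]] p_nonneg by auto
qed

section \<open>The weighted space of square summable functions\<close>

lemma L2_iff: "f \<in> L2 \<longleftrightarrow> (\<lambda>x. m x * (cmod (f x))\<^sup>2) summable_on UNIV"
  by (simp add: l2m_def)

lemma L2_bound:
  assumes "f1 \<in> L2" "f2 \<in> L2" "\<And>x. (cmod (f x))\<^sup>2 \<le> C * ((cmod (f1 x))\<^sup>2 + (cmod (f2 x))\<^sup>2)"
  shows "f \<in> L2"
proof -
  have "(\<lambda>x. C * (m x * (cmod (f1 x))\<^sup>2 + m x * (cmod (f2 x))\<^sup>2)) summable_on UNIV"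
    using assms(1,2) unfolding L2_iff by (intro summable_on_cmult_right summable_on_add)
  then show ?thesis unfolding L2_iff
  proof (rule summable_on_comparison_test)
    fix x
    have "m x * (cmod (f x))\<^sup>2 \<le> m x * (C * ((cmod (f1 x))\<^sup>2 + (cmod (f2 x))\<^sup>2))"
      using assms(3) m_pos[of x] by (intro mult_left_mono) auto
    then show "m x * (cmod (f x))\<^sup>2 \<le> C * (m x * (cmod (f1 x))\<^sup>2 + m x * (cmod (f2 x))\<^sup>2)"
      by (simp add: algebra_simps)
    show "0 \<le> m x * (cmod (f x))\<^sup>2" using m_pos[of x] by simp
  qed
qed

lemma L2_cmult: "f \<in> L2 \<Longrightarrow> (\<lambda>x. c * f x) \<in> L2"
  by (rule L2_bound[where C = "(cmod c)\<^sup>2" and ?f1.0 = f and ?f2.0 = f])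
    (auto simp: norm_mult power_mult_distrib algebra_simps)

lemma L2_add:
  assumes "f1 \<in> L2" "f2 \<in> L2" shows "(\<lambda>x. f1 x + f2 x) \<in> L2"
proof (rule L2_bound[OF assms, where C = 2])
  fix x
  have "(cmod (f1 x + f2 x))\<^sup>2 \<le> (cmod (f1 x) + cmod (f2 x))\<^sup>2"
    by (intro power_mono norm_triangle_ineq norm_ge_zero)
  also have "\<dots> \<le> 2 * ((cmod (f1 x))\<^sup>2 + (cmod (f2 x))\<^sup>2)"
    using sum_squares_ge_zero[of "cmod (f1 x) - cmod (f2 x)" 0]
    by (simp add: power2_eq_square algebra_simps)
  finally show "(cmod (f1 x + f2 x))\<^sup>2 \<le> 2 * ((cmod (f1 x))\<^sup>2 + (cmod (f2 x))\<^sup>2)" .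
qed

lemma L2_If: "f1 \<in> L2 \<Longrightarrow> f2 \<in> L2 \<Longrightarrow> (\<lambda>x. if P x then f1 x else f2 x) \<in> L2"
  by (rule L2_bound[where C = 1 and ?f1.0 = f1 and ?f2.0 = f2]) auto

lemma L2_delta: "(\<lambda>x. if x = y then 1 else 0) \<in> L2"
proof -
  have "(\<lambda>x. m x * (cmod (if x = y then 1 else 0))\<^sup>2) summable_on {y}" by simp
  moreover have "(\<lambda>x. m x * (cmod (if x = y then 1 else 0))\<^sup>2) summable_on UNIV \<longleftrightarrow>
      (\<lambda>x. m x * (cmod (if x = y then 1 else 0))\<^sup>2) summable_on {y}"
    by (rule summable_on_cong_neutral) auto
  ultimately show ?thesis unfolding L2_iff by blast
qed

text \<open>The bound t \<le> 1 + t^2 splits the sum: the first part converges because P is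
  stochastic, the second because reversibility gives m(x) p(x,z) \<le> m(z).\<close>

lemma L2_summable:
  assumes "f \<in> L2" shows "(\<lambda>z. norm (complex_of_real (p x z) * f z)) summable_on UNIV"
proof -
  have "(\<lambda>z. p x z + inverse (m x) * (m z * (cmod (f z))\<^sup>2)) summable_on UNIV"
    using assms has_sum_imp_summable[OF p_sum[of x]] unfolding L2_iff
    by (intro summable_on_cmult_right summable_on_add) auto
  then show ?thesis
  proof (rule summable_on_comparison_test)
    fix z
    have a: "cmod (f z) \<le> 1 + (cmod (f z))\<^sup>2"
    proof (cases "cmod (f z) \<le> 1")
      case False
      then have "cmod (f z) \<le> (cmod (f z))\<^sup>2" by (simp add: self_le_power)
      then show ?thesis by simp
    qed (simp add: add_increasing2)
    have "m x * p x z \<le> m z" using m_reversible[of x z] p_le_1[of z x] m_pos[of z] by (simp add: mult_left_le)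
    then have b: "p x z \<le> inverse (m x) * m z" using m_pos[of x] by (simp add: field_simps)
    have "norm (complex_of_real (p x z) * f z) = p x z * cmod (f z)"
      using p_nonneg by (simp add: norm_mult)
    also have "\<dots> \<le> p x z * (1 + (cmod (f z))\<^sup>2)" using a p_nonneg by (intro mult_left_mono)
    also have "\<dots> \<le> p x z + inverse (m x) * (m z * (cmod (f z))\<^sup>2)"
      using mult_right_mono[OF b, of "(cmod (f z))\<^sup>2"] by (simp add: algebra_simps)
    finally show "norm (complex_of_real (p x z) * f z) \<le> p x z + inverse (m x) * (m z * (cmod (f z))\<^sup>2)" .
  qed simp
qed

lemma Pop_linear:
  assumes "f1 \<in> L2" "f2 \<in> L2"
  shows "Pop p (\<lambda>x. f1 x + c * f2 x) x = Pop p f1 x + c * Pop p f2 x"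
proof -
  note s = abs_summable_summable[OF L2_summable[OF assms(1), of x]] abs_summable_summable[OF L2_summable[OF assms(2), of x]]
  have "Pop p (\<lambda>x. f1 x + c * f2 x) x
     = (\<Sum>\<^sub>\<infinity>y. complex_of_real (p x y) * f1 y + c * (complex_of_real (p x y) * f2 y))"
    unfolding Pop_def by (rule infsum_cong) (simp add: algebra_simps)
  also have "\<dots> = Pop p f1 x + c * Pop p f2 x"
    unfolding Pop_def using infsum_add[OF s(1) summable_on_cmult_right[OF s(2)], of c]
    by (simp add: infsum_cmult_right')
  finally show ?thesis .
qed

context
  fixes lam :: complex
  assumes res: "lam \<in> resP adj p rt"
begin

section \<open>The resolvent kernel\<close>

abbreviation "R \<equiv> Gres adj p rt lam"

lemma resolvent_inj:
  assumes "f1 \<in> L2" "f2 \<in> L2" "\<And>x. lam * f1 x - Pop p f1 x = lam * f2 x - Pop p f2 x"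
  shows "f1 = f2"
proof -
  have "inj_on (\<lambda>f x. lam * f x - Pop p f x) L2"
    using res by (simp add: resP_def bij_betw_def)
  from inj_onD[OF this _ assms(1,2)] assms(3) show ?thesis by blast
qed

lemma Gres_L2: "(\<lambda>x. R x y) \<in> L2"
  and Gres_eq: "lam * R x y - Pop p (\<lambda>z. R z y) x = (if x = y then 1 else 0)"
proof -
  let ?P = "\<lambda>f. f \<in> L2 \<and> (\<forall>z. lam * f z - Pop p f z = (if z = y then 1 else 0))"
  have "(\<lambda>z. if z = y then 1 else 0) \<in> (\<lambda>f x. lam * f x - Pop p f x) ` L2"
    using res L2_delta[of y] by (simp add: resP_def bij_betw_def)
  then obtain f where f: "f \<in> L2" "(\<lambda>z. if z = y then 1 else 0) = (\<lambda>x. lam * f x - Pop p f x)"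
    by auto
  have "\<exists>!f. ?P f"
  proof (rule ex1I[of _ f])
    show "?P f" using f(1) fun_cong[OF f(2)] by simp
    fix f' assume "?P f'"
    then show "f' = f" using resolvent_inj[of f' f] f(1) fun_cong[OF f(2)] by simp
  qed
  from theI'[OF this] have P: "?P (\<lambda>x. R x y)" unfolding Gres_def by simp
  then show "(\<lambda>x. R x y) \<in> L2" by blast
  show "lam * R x y - Pop p (\<lambda>z. R z y) x = (if x = y then 1 else 0)" using P by blast
qed

text \<open>Gluing a multiple of \<open>G(\<cdot>,w)\<close> inside \<open>A\<close> to \<open>G(\<cdot>,y)\<close> outside produces an \<open>\<ell>\<^sup>2\<close> function whose image
  under \<open>\<lambda>I - P\<close> differs from \<open>1\<^sub>y\<close> at most at \<open>w\<close>; evaluation at \<open>w\<close> shows that it does not differ.\<close>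

lemma Gres_separation:
  assumes nz: "R w w \<noteq> 0" and w: "w \<in> A"
    and A: "\<And>z z'. z \<in> A \<Longrightarrow> z \<noteq> w \<Longrightarrow> adj z z' \<Longrightarrow> z' \<in> A"
    and y: "y \<notin> A - {w}" and x: "x \<in> A"
  shows "R x y * R w w = R x w * R w y"
proof -
  define a where "a = R w y / R w w"
  define u where "u z = (if z \<in> A then a * R z w else R z y)" for z
  have uw: "u w = R w y" using w nz by (simp add: u_def a_def)
  have uL: "u \<in> L2" unfolding u_def[abs_def] by (intro L2_If L2_cmult Gres_L2)
  have Pa: "Pop p (\<lambda>z. a * R z w) v = a * Pop p (\<lambda>z. R z w) v" for v
    using Pop_linear[OF L2_cmult[OF Gres_L2, of 0] Gres_L2, of w a w v] by (simp add: Pop_def)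
  have P1: "Pop p u v = a * Pop p (\<lambda>z. R z w) v" if "v \<in> A" "v \<noteq> w" for v
  proof -
    have "Pop p u v = Pop p (\<lambda>z. a * R z w) v"
      unfolding Pop_def
    proof (rule infsum_cong)
      fix z
      show "complex_of_real (p v z) * u z = complex_of_real (p v z) * (a * R z w)"
        using A[OF that, of z] p_eq_0_iff[of v z] by (cases "adj v z") (auto simp: u_def)
    qed
    then show ?thesis using Pa by simp
  qed
  have P2: "Pop p u v = Pop p (\<lambda>z. R z y) v" if "v \<notin> A" for v
    unfolding Pop_def
  proof (rule infsum_cong)
    fix z
    have "u z = R z y" if "adj v z"
    proof (cases "z \<in> A")
      case True
      \<comment> \<open>From outside, A is entered only at w, where both branches of
        \<open>u\<close> have the value \<open>R w y\<close>.\<close>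
      then have "z = w" using A[of z v] \<open>v \<notin> A\<close> adj_sym[OF that] by blast
      then show ?thesis using uw by simp
    qed (simp add: u_def)
    then show "complex_of_real (p v z) * u z = complex_of_real (p v z) * R z y"
      using p_eq_0_iff[of v z] by (cases "adj v z") auto
  qed
  define c where "c = lam * u w - Pop p u w - (if w = y then 1 else 0)"
  have eq: "lam * u v - Pop p u v = (if v = y then 1 else 0) + c * (if v = w then 1 else 0)" for v
  proof (cases "v = w")
    case True then show ?thesis by (simp add: c_def)
  next
    case vw: False
    show ?thesis
    proof (cases "v \<in> A")
      case True
      have "lam * u v - Pop p u v = a * (lam * R v w - Pop p (\<lambda>z. R z w) v)"
        using True P1[OF True vw] by (simp add: u_def algebra_simps)
      also have "\<dots> = 0" using Gres_eq[of v w] vw by simp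
      finally show ?thesis using True vw y by auto
    next
      case False
      then show ?thesis using P2[OF False] Gres_eq[of v y] vw by (simp add: u_def)
    qed
  qed
  have "u = (\<lambda>z. R z y + c * R z w)"
  proof (rule resolvent_inj[OF uL])
    show "(\<lambda>z. R z y + c * R z w) \<in> L2" by (intro L2_add L2_cmult Gres_L2)
    fix v
    have "lam * (R v y + c * R v w) - Pop p (\<lambda>z. R z y + c * R z w) v
      = (lam * R v y - Pop p (\<lambda>z. R z y) v) + c * (lam * R v w - Pop p (\<lambda>z. R z w) v)"
      unfolding Pop_linear[OF Gres_L2 Gres_L2] by (simp add: algebra_simps)
    then show "lam * u v - Pop p u v = lam * (R v y + c * R v w) - Pop p (\<lambda>z. R z y + c * R z w) v"
      unfolding Gres_eq eq by simp
  qed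
  then have uz: "u z = R z y + c * R z w" for z by simp
  with uw nz have "c = 0" by simp
  with uz[of x] x have "a * R x w = R x y" by (simp add: u_def)
  then show ?thesis using nz by (auto simp: a_def field_simps)
qed

lemma green_kernel_Gres:
  assumes "\<And>x. R x x \<noteq> 0" shows "green_kernel adj p lam (Green adj p rt lam)"
proof -
  have G: "Green adj p rt lam = R" by (intro ext) (simp add: Green_def res)
  show ?thesis
    unfolding green_kernel_def G
  proof (intro conjI allI impI)
    show "(\<lambda>z. complex_of_real (p x z) * R z y) summable_on UNIV" for x y
      using L2_summable[OF Gres_L2] by (rule abs_summable_summable)
    show "lam * R x y - (\<Sum>\<^sub>\<infinity>z. complex_of_real (p x z) * R z y) = (if x = y then 1 else 0)" for x y
      using Gres_eq[of x y] by (simp add: Pop_def)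
  qed (use assms Gres_separation in blast)+
qed

text \<open>Ground state transform: for a positive \<open>\<rho>\<close>-superharmonic \<open>f\<close>, the form of \<open>\<rho>I - P\<close> at \<open>u\<close> is at
  least half the sum of \<open>m(x) p(x,z) f(x) f(z) (u(x)/f(x) - u(z)/f(z))\<^sup>2\<close>. If \<open>G(y,y) = 0\<close>, then
  \<open>u = |G(\<cdot>,y)|\<close> is \<open>\<rho>\<close>-subharmonic and vanishes at \<open>y\<close>, whence \<open>u/f\<close> is constant and \<open>u = 0\<close>.\<close>

lemma Gres_diag_nonzero:
  assumes fpos: "\<And>x. f x > (0::real)"
    and fsum: "\<And>x. (\<lambda>z. p x z * f z) summable_on UNIV"
    and fsuper: "\<And>x. (\<Sum>\<^sub>\<infinity>z. p x z * f z) \<le> cmod lam * f x"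
  shows "R y y \<noteq> 0"
proof
  assume Ry: "R y y = 0"
  define u where "u x = cmod (R x y)" for x
  have un: "u x \<ge> 0" for x by (simp add: u_def)
  have mn: "m x \<ge> 0" for x using m_pos[of x] by simp
  have us: "(\<lambda>x. m x * (u x)\<^sup>2) summable_on UNIV"
    using Gres_L2[of y] unfolding L2_iff u_def .
  have sub: "cmod lam * u x \<le> (\<Sum>\<^sub>\<infinity>z. p x z * u z)" for x
  proof (cases "x = y")
    \<comment> \<open>At y, where the resolvent equation has its unit, the left side vanishes by
      assumption.\<close>
    case True
    then show ?thesis using Ry by (simp add: u_def infsum_nonneg p_nonneg)
  next
    case False
    then have "lam * R x y = Pop p (\<lambda>z. R z y) x" using Gres_eq[of x y] by simp
    then have "cmod lam * u x = cmod (Pop p (\<lambda>z. R z y) x)" by (simp add: u_def norm_mult[symmetric])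
    also have "\<dots> \<le> (\<Sum>\<^sub>\<infinity>z. norm (complex_of_real (p x z) * R z y))"
      unfolding Pop_def by (rule norm_infsum_bound[OF L2_summable[OF Gres_L2]])
    also have "\<dots> = (\<Sum>\<^sub>\<infinity>z. p x z * u z)" using p_nonneg by (simp add: u_def norm_mult)
    finally show ?thesis .
  qed
  define E where "E = (\<Sum>\<^sub>\<infinity>x. m x * (u x)\<^sup>2)"
  \<comment> \<open>A squeeze: summed over all pairs, \<open>b\<close> and \<open>b'\<close> each
    give at most |lam| E since f is superharmonic, \<open>a\<close> gives at least |lam| E since u
    is subharmonic, and 2a \<le> b + b' pointwise. So equality holds for every pair.\<close>
  define a where "a xz = (case xz of (x, z) \<Rightarrow> m x * u x * (p x z * u z))" for xz
  define b where "b xz = (case xz of (x, z) \<Rightarrow> m x * (u x)\<^sup>2 / f x * (p x z * f z))" for xz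
  define b' where "b' xz = (case xz of (x, z) \<Rightarrow> b (z, x))" for xz
  have an: "a xz \<ge> 0" for xz using mn un p_nonneg by (cases xz) (simp add: a_def)
  have bn: "b xz \<ge> 0" for xz
    using mn p_nonneg fpos[THEN less_imp_le] by (cases xz) (simp add: b_def)
  have brow: "(\<lambda>z. b (x, z)) summable_on UNIV" "(\<Sum>\<^sub>\<infinity>z. b (x, z)) \<le> cmod lam * (m x * (u x)\<^sup>2)" for x
  proof -
    show "(\<lambda>z. b (x, z)) summable_on UNIV"
      unfolding b_def prod.case by (rule summable_on_cmult_right[OF fsum])
    have "(\<Sum>\<^sub>\<infinity>z. b (x, z)) = m x * (u x)\<^sup>2 / f x * (\<Sum>\<^sub>\<infinity>z. p x z * f z)"
      unfolding b_def prod.case by (rule infsum_cmult_right')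
    also have "\<dots> \<le> m x * (u x)\<^sup>2 / f x * (cmod lam * f x)"
      using mn fpos[of x] by (intro mult_left_mono fsuper) simp
    finally show "(\<Sum>\<^sub>\<infinity>z. b (x, z)) \<le> cmod lam * (m x * (u x)\<^sup>2)" using fpos[of x] by (simp add: field_simps)
  qed
  have browsum: "(\<lambda>x. \<Sum>\<^sub>\<infinity>z. b (x, z)) summable_on UNIV"
    by (rule summable_on_comparison_test[OF summable_on_cmult_right[OF us, of "cmod lam"]])
      (use brow(2) bn in \<open>auto intro: infsum_nonneg\<close>)
  have bs: "b summable_on UNIV \<times> UNIV"
  proof -
    have "(\<lambda>xz. norm (b xz)) summable_on Sigma UNIV (\<lambda>_. UNIV)"
      by (rule Infinite_Sum.abs_summable_on_Sigma_iff[THEN iffD2])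
        (use brow(1) browsum bn in \<open>simp add: infsum_nonneg\<close>)
    then show ?thesis by (rule abs_summable_summable)
  qed
  have b's: "b' summable_on UNIV \<times> UNIV" and b'I: "infsum b' (UNIV \<times> UNIV) = infsum b (UNIV \<times> UNIV)"
  proof -
    have "(b' has_sum infsum b (UNIV \<times> UNIV)) (UNIV \<times> UNIV)"
      unfolding b'_def[abs_def] has_sum_swap[symmetric] using bs by (rule has_sum_infsum)
    then show "b' summable_on UNIV \<times> UNIV" "infsum b' (UNIV \<times> UNIV) = infsum b (UNIV \<times> UNIV)"
      by (auto intro: has_sum_imp_summable infsumI)
  qed
  have bI: "infsum b (UNIV \<times> UNIV) \<le> cmod lam * E"
  proof -
    have "infsum b (UNIV \<times> UNIV) = (\<Sum>\<^sub>\<infinity>x. \<Sum>\<^sub>\<infinity>z. b (x, z))"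
      using infsum_Sigma_banach[OF bs] by simp
    also have "\<dots> \<le> (\<Sum>\<^sub>\<infinity>x. cmod lam * (m x * (u x)\<^sup>2))"
      by (rule infsum_mono[OF browsum summable_on_cmult_right[OF us] brow(2)])
    finally show ?thesis by (simp add: E_def infsum_cmult_right')
  qed
  have square: "b xz + b' xz - 2 * a xz
      = (case xz of (x, z) \<Rightarrow> m x * p x z * f x * f z * (u x / f x - u z / f z)\<^sup>2)" for xz
  proof -
    obtain x z where xz: "xz = (x, z)" by force
    have "b (z, x) = (m z * p z x) * ((u z)\<^sup>2 / f z * f x)" by (simp add: b_def)
    also have "\<dots> = (m x * p x z) * ((u z)\<^sup>2 / f z * f x)" using m_reversible[of x z] by simp
    finally have "b xz + b' xz - 2 * a xz
        = (m x * p x z) * ((u x)\<^sup>2 / f x * f z + (u z)\<^sup>2 / f z * f x - 2 * u x * u z)"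
      unfolding xz b'_def prod.case by (simp add: a_def b_def algebra_simps)
    also have "(u x)\<^sup>2 / f x * f z + (u z)\<^sup>2 / f z * f x - 2 * u x * u z
       = f x * f z * (u x / f x - u z / f z)\<^sup>2"
      using fpos[of x] fpos[of z] by (simp add: power2_eq_square field_simps)
    finally show ?thesis unfolding xz by (simp add: algebra_simps)
  qed
  have sqn: "b xz + b' xz - 2 * a xz \<ge> 0" for xz
    unfolding square using mn p_nonneg fpos[THEN less_imp_le] by (cases xz) simp
  have as: "a summable_on UNIV \<times> UNIV"
  proof (rule summable_on_comparison_test[OF summable_on_add[OF bs b's]])
    show "a xz \<le> b xz + b' xz" for xz using sqn[of xz] an[of xz] by linarith
  qed (rule an)
  have aI: "cmod lam * E \<le> infsum a (UNIV \<times> UNIV)"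
  proof -
    have arow: "(\<Sum>\<^sub>\<infinity>z. a (x, z)) = m x * u x * (\<Sum>\<^sub>\<infinity>z. p x z * u z)" for x
      unfolding a_def prod.case by (rule infsum_cmult_right')
    have "cmod lam * E = (\<Sum>\<^sub>\<infinity>x. cmod lam * (m x * (u x)\<^sup>2))"
      by (simp add: E_def infsum_cmult_right')
    also have "\<dots> \<le> (\<Sum>\<^sub>\<infinity>x. \<Sum>\<^sub>\<infinity>z. a (x, z))"
    proof (rule infsum_mono[OF summable_on_cmult_right[OF us]])
      show "(\<lambda>x. \<Sum>\<^sub>\<infinity>z. a (x, z)) summable_on UNIV"
        using summable_on_Sigma_banach[of "\<lambda>x z. a (x, z)" UNIV "\<lambda>_. UNIV"] as by simp
      fix x
      show "cmod lam * (m x * (u x)\<^sup>2) \<le> (\<Sum>\<^sub>\<infinity>z. a (x, z))"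
        using mult_left_mono[OF sub[of x], of "m x * u x"] mn[of x] un[of x]
        unfolding arow by (simp add: power2_eq_square algebra_simps)
    qed
    also have "\<dots> = infsum a (UNIV \<times> UNIV)" using infsum_Sigma_banach[OF as] by simp
    finally show ?thesis .
  qed
  have tot: "((\<lambda>xz. b xz + b' xz - 2 * a xz) has_sum
      (infsum b (UNIV \<times> UNIV) + infsum b (UNIV \<times> UNIV) - 2 * infsum a (UNIV \<times> UNIV))) (UNIV \<times> UNIV)"
    using has_sum_add[OF has_sum_add[OF has_sum_infsum[OF bs] has_sum_infsum[OF b's]]
        has_sum_cmult_right[OF has_sum_infsum[OF as], of "-2"]] b'I by simp
  have zero: "b xz + b' xz - 2 * a xz = 0" for xz
    by (rule nonneg_has_sum_le_0D[OF tot _ sqn]) (use aI bI in auto)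
  have edge: "u x / f x = u z / f z" if "adj x z" for x z
  proof -
    have "p x z > 0" using p_pos_iff that by blast
    then show ?thesis using zero[of "(x, z)"] m_pos[of x] fpos[of x] fpos[of z] unfolding square by simp
  qed
  have "u x / f x = 0" for x
    using adj_connected[of y x]
  proof (induction rule: rtranclp_induct)
    case base
    show ?case using Ry by (simp add: u_def)
  qed (use edge in metis)
  then have "R x y = 0" for x using fpos[of x] by (metis divide_eq_0_iff less_irrefl norm_eq_zero u_def)
  then show False using Gres_eq[of y y] by (simp add: Pop_def)
qed

end

end

section \<open>The Green series\<close>

text \<open>The probability that the walk from x visits w for the first time at time k, given by
  conditioning on the first step.\<close>

primrec first_passage :: "('v \<Rightarrow> 'v \<Rightarrow> real) \<Rightarrow> 'v \<Rightarrow> nat \<Rightarrow> 'v \<Rightarrow> real" where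
  "first_passage p w 0 x = (if x = w then 1 else 0)"
| "first_passage p w (Suc k) x = (if x = w then 0 else (\<Sum>\<^sub>\<infinity>z. p x z * first_passage p w k z))"

lemma has_sum_sum_finite:
  fixes f :: "'i \<Rightarrow> 'b \<Rightarrow> 'c :: topological_comm_monoid_add"
  assumes "finite I" "\<And>i. i \<in> I \<Longrightarrow> (f i has_sum s i) A"
  shows "((\<lambda>x. \<Sum>i\<in>I. f i x) has_sum (\<Sum>i\<in>I. s i)) A"
  using assms by (induction I rule: finite_induct) (auto intro: has_sum_add)

context tree_walk
begin

section \<open>Transition probabilities and first passages\<close>

lemma p_mult_summable:
  assumes "\<And>z. 0 \<le> f z" "\<And>z. f z \<le> 1" shows "(\<lambda>z. p x z * f z) summable_on UNIV"
  by (rule summable_on_comparison_test[OF has_sum_imp_summable[OF p_sum[of x]]])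
    (use assms p_nonneg in \<open>auto intro: mult_left_le\<close>)

lemma pn_bounds: "0 \<le> pn p n x y \<and> pn p n x y \<le> 1"
proof (induction n arbitrary: x)
  case (Suc n)
  have "(\<Sum>\<^sub>\<infinity>z. p x z * pn p n z y) \<le> (\<Sum>\<^sub>\<infinity>z. p x z)"
    using Suc p_nonneg has_sum_imp_summable[OF p_sum[of x]]
    by (intro infsum_mono p_mult_summable) (auto intro: mult_left_le)
  also have "\<dots> = 1" using p_sum infsumI by blast
  finally show ?case using Suc p_nonneg by (auto intro: infsum_nonneg)
qed auto

lemma pn_has_sum: "((\<lambda>z. p x z * pn p n z y) has_sum pn p (Suc n) x y) UNIV"
  using has_sum_infsum[OF p_mult_summable[of "\<lambda>z. pn p n z y" x]] pn_bounds by simp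

lemma pn_Suc_ge: "p x z * pn p n z y \<le> pn p (Suc n) x y"
proof -
  have "((\<lambda>z. p x z * pn p n z y) has_sum p x z * pn p n z y) {z}"
    using has_sum_finite[of "{z}" "\<lambda>z. p x z * pn p n z y"] by simp
  from has_sum_mono2[OF this pn_has_sum] show ?thesis using p_nonneg pn_bounds by auto
qed

lemma pn_pos: "\<exists>n. pn p n x y > 0"
  using adj_connected[of x y]
proof (induction rule: converse_rtranclp_induct)
  case base
  show ?case by (rule exI[of _ 0]) simp
next
  case (step x z)
  then obtain n where "pn p n z y > 0" by blast
  with step(1) have "p x z * pn p n z y > 0" using p_pos_iff by simp
  with pn_Suc_ge[of x z n y] show ?case by (intro exI[of _ "Suc n"]) linarith
qed

text \<open>Each step changes the distance from the root by one. This serves \<lambda> = -\<rho>,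
  where return terms of odd order would have the wrong sign.\<close>

lemma pn_parity: "pn p n x y \<noteq> 0 \<Longrightarrow> even (n + length (gl x) + length (gl y))"
proof (induction n arbitrary: x)
  case 0
  then show ?case by (auto split: if_splits)
next
  case (Suc n)
  have "\<exists>z. p x z * pn p n z y \<noteq> 0"
  proof (rule ccontr)
    assume "\<not> ?thesis"
    then have "pn p (Suc n) x y = 0" unfolding pn.simps(2) by (intro infsum_0) blast
    with Suc.prems show False by simp
  qed
  then obtain z where z: "p x z \<noteq> 0" "pn p n z y \<noteq> 0" by auto
  then have "adj x z" using p_eq_0_iff by blast
  then have "length (gl z) = Suc (length (gl x)) \<or> length (gl x) = Suc (length (gl z))"
    using adj_gl[of x z] by (metis length_append_singleton)
  with Suc.IH[OF z(2)] show ?case by auto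
qed

text \<open>Going back and forth along one edge at the root bounds the even return probabilities
  from below. The upper bound 1 matters because \<open>real_of_ereal\<close> sends an infinite
  limsup to 0.\<close>

lemma rho_pos: "rho p rt > 0"
proof -
  obtain z where z: "adj rt z" using has_nbr by blast
  define c where "c = p rt z * p z rt"
  have c0: "c > 0" using p_pos_iff z adj_sym unfolding c_def by simp
  have lower: "pn p (2 * n) rt rt \<ge> c ^ n" for n
  proof (induction n)
    case (Suc n)
    have "c ^ Suc n \<le> p rt z * (p z rt * pn p (2 * n) rt rt)"
      using mult_left_mono[OF Suc, of c] c0 by (simp add: c_def mult.assoc)
    also have "\<dots> \<le> p rt z * pn p (Suc (2 * n)) z rt"
      using pn_Suc_ge p_nonneg by (intro mult_left_mono) auto
    also have "\<dots> \<le> pn p (Suc (Suc (2 * n))) rt rt" by (rule pn_Suc_ge)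
    finally show ?case by simp
  qed simp
  let ?X = "\<lambda>n. ereal (root n (pn p n rt rt))"
  have ge: "ereal (sqrt c) \<le> ?X (2 * n)" if "n > 0" for n
  proof -
    have "sqrt c = root (2 * n) (c ^ n)"
      using that c0 by (simp add: real_root_mult_exp real_root_power_cancel sqrt_def)
    also have "\<dots> \<le> root (2 * n) (pn p (2 * n) rt rt)"
      using lower that by (intro real_root_le_mono) auto
    finally show ?thesis by simp
  qed
  have "ereal (sqrt c) \<le> limsup ?X"
  proof -
    \<comment> \<open>\<open>2 * Suc n\<close> skips the index 0, where \<open>root 0\<close> is 0
      by convention.\<close>
    have "\<forall>n. ereal (sqrt c) \<le> (?X \<circ> (\<lambda>n. 2 * Suc n)) n"
      unfolding o_apply using ge by blast
    then have "ereal (sqrt c) \<le> liminf (?X \<circ> (\<lambda>n. 2 * Suc n))"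
      by (intro Liminf_bounded always_eventually)
    also have "\<dots> \<le> limsup (?X \<circ> (\<lambda>n. 2 * Suc n))" by (rule Liminf_le_Limsup) simp
    also have "\<dots> \<le> limsup ?X" by (rule limsup_subseq_mono) (simp add: strict_mono_def)
    finally show ?thesis .
  qed
  moreover have "limsup ?X \<le> 1"
  proof (rule Limsup_bounded, rule always_eventually, rule allI)
    fix n
    show "?X n \<le> 1"
      using pn_bounds[of n rt rt] by (cases "n = 0") (auto simp: one_ereal_def)
  qed
  moreover have "sqrt c > 0" using c0 by simp
  ultimately show ?thesis unfolding rho_def
    by (cases "limsup ?X") (auto simp: one_ereal_def simp del: real_sqrt_gt_0_iff)
qed

lemma first_passage_bounds: "0 \<le> first_passage p w k x \<and> first_passage p w k x \<le> pn p k x w"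
proof (induction k arbitrary: x)
  case (Suc k)
  have "first_passage p w k z \<le> 1" for z
    using Suc[of z] pn_bounds[of k z w] by linarith
  then have "(\<Sum>\<^sub>\<infinity>z. p x z * first_passage p w k z) \<le> (\<Sum>\<^sub>\<infinity>z. p x z * pn p k z w)"
    using Suc p_nonneg pn_bounds by (intro infsum_mono p_mult_summable mult_left_mono) auto
  moreover have "0 \<le> (\<Sum>\<^sub>\<infinity>z. p x z * first_passage p w k z)"
    using Suc p_nonneg by (intro infsum_nonneg) simp
  ultimately show ?case using pn_bounds[of "Suc k" x w] by auto
qed auto

text \<open>A walk from A to y has to visit w and stays in A until then; this keeps the hypothesis x
  \<in> A alive under first-step induction.\<close>

lemma pn_first_passage:
  assumes w: "w \<in> A" and A: "\<And>z z'. z \<in> A \<Longrightarrow> z \<noteq> w \<Longrightarrow> adj z z' \<Longrightarrow> z' \<in> A"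
    and y: "y \<notin> A - {w}" and x: "x \<in> A"
  shows "pn p n x y = (\<Sum>k\<le>n. first_passage p w k x * pn p (n - k) w y)"
  using x
proof (induction n arbitrary: x)
  case 0
  then show ?case using y by auto
next
  case (Suc n)
  show ?case
  proof (cases "x = w")
    case True
    have "first_passage p w (Suc k) x = 0" for k using True by simp
    then show ?thesis
      using True unfolding sum.atMost_Suc_shift by (simp del: pn.simps(2) first_passage.simps(2))
  next
    case False
    have s: "(\<lambda>z. p x z * first_passage p w k z) summable_on UNIV" for k
      using first_passage_bounds[of w k] pn_bounds[of k _ w]
      by (intro p_mult_summable) (blast intro: order_trans)+
    have "pn p (Suc n) x y = (\<Sum>\<^sub>\<infinity>z. \<Sum>k\<le>n. pn p (n - k) w y * (p x z * first_passage p w k z))"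
      unfolding pn.simps(2)
    proof (rule infsum_cong)
      fix z
      show "p x z * pn p n z y = (\<Sum>k\<le>n. pn p (n - k) w y * (p x z * first_passage p w k z))"
      proof (cases "adj x z")
        case True
        then have "z \<in> A" using A Suc.prems False by blast
        then show ?thesis unfolding Suc.IH[OF \<open>z \<in> A\<close>] sum_distrib_left
          by (intro sum.cong) (auto simp: algebra_simps)
      next
        case False
        then have "p x z = 0" using p_eq_0_iff by blast
        then show ?thesis by simp
      qed
    qed
    also have "\<dots> = (\<Sum>k\<le>n. \<Sum>\<^sub>\<infinity>z. pn p (n - k) w y * (p x z * first_passage p w k z))"
      by (intro infsumI has_sum_sum_finite has_sum_infsum summable_on_cmult_right s) simp
    also have "\<dots> = (\<Sum>k\<le>n. first_passage p w (Suc k) x * pn p (n - k) w y)"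
      using False by (intro sum.cong) (auto simp: infsum_cmult_right')
    finally show ?thesis using False unfolding sum.atMost_Suc_shift
      by (simp del: pn.simps(2) first_passage.simps(2))
  qed
qed

section \<open>The Green series at a radius where it converges\<close>

context
  fixes r :: real
  assumes r: "r > 0" and ser: "\<And>x y. summable (\<lambda>n. pn p n x y / r ^ Suc n)"
begin

lemma series_summable_norm:
  fixes lam :: "'a :: {real_normed_field, banach}"
  assumes "norm lam = r"
  shows "summable (\<lambda>n. norm (of_real (pn p n x y) / lam ^ Suc n))"
  using ser[of x y] pn_bounds assms by (simp add: norm_divide norm_mult norm_power)

text \<open>Fubini for \<open>H n z\<close>: summing over z gives the next transition probability,
  summing over n gives the series. The field stays open since the complex instance yields the Green
  kernel and the real one a positive superharmonic function.\<close>

lemma series_resolvent: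
  fixes lam :: "'a :: {real_normed_field, banach}"
  assumes lam: "norm lam = r"
  defines "G \<equiv> \<lambda>x y. \<Sum>n. of_real (pn p n x y) / lam ^ Suc n"
  shows "(\<lambda>z. of_real (p x z) * G z y) summable_on UNIV"
    and "lam * G x y - (\<Sum>\<^sub>\<infinity>z. of_real (p x z) * G z y) = (if x = y then 1 else 0)"
proof -
  have lam0: "lam \<noteq> 0" using lam r by auto
  define H where "H n z = of_real (p x z) * (of_real (pn p n z y) / lam ^ Suc n)" for n z
  have nH: "norm (H n z) = p x z * pn p n z y * inverse (r ^ Suc n)" for n z
    unfolding H_def using p_nonneg pn_bounds lam
    by (simp add: norm_mult norm_divide norm_power norm_inverse divide_inverse)
  have row: "((\<lambda>z. norm (H n z)) has_sum pn p (Suc n) x y * inverse (r ^ Suc n)) UNIV" for n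
    unfolding nH by (rule has_sum_cmult_left[OF pn_has_sum])
  have rows: "summable (\<lambda>n. pn p (Suc n) x y * inverse (r ^ Suc n))"
  proof -
    have "summable (\<lambda>n. r * (pn p (Suc n) x y / r ^ Suc (Suc n)))"
      by (intro summable_mult) (use ser[of x y] in \<open>subst summable_Suc_iff\<close>)
    moreover have "r * (pn p (Suc n) x y / r ^ Suc (Suc n)) = pn p (Suc n) x y * inverse (r ^ Suc n)" for n
      using r by (simp add: field_simps del: pn.simps(2))
    ultimately show ?thesis by (simp only:)
  qed
  have "(\<lambda>nz. norm (case nz of (n, z) \<Rightarrow> H n z)) summable_on UNIV \<times> UNIV"
  proof (rule Infinite_Sum.abs_summable_on_Sigma_iff[THEN iffD2], intro conjI ballI)
    show "(\<lambda>z. norm (case (n, z) of (n, z) \<Rightarrow> H n z)) summable_on UNIV" for n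
      using has_sum_imp_summable[OF row[of n]] by simp
    have "(\<lambda>n. pn p (Suc n) x y * inverse (r ^ Suc n)) summable_on UNIV"
      using rows pn_bounds r by (subst summable_on_UNIV_nonneg_real_iff) (auto simp del: pn.simps(2))
    then show "(\<lambda>n. norm (\<Sum>\<^sub>\<infinity>z. norm (case (n, z) of (n, z) \<Rightarrow> H n z))) summable_on UNIV"
      using infsumI[OF row] pn_bounds r by (simp del: pn.simps(2))
  qed
  then have HS: "(\<lambda>(n, z). H n z) summable_on UNIV \<times> UNIV"
    by (rule abs_summable_summable)
  have col: "(\<Sum>\<^sub>\<infinity>n. H n z) = of_real (p x z) * G z y" for z
  proof -
    have "((\<lambda>n. of_real (pn p n z y) / lam ^ Suc n) has_sum G z y) UNIV"
      unfolding G_def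
      by (intro norm_summable_imp_has_sum series_summable_norm lam summable_sums
          summable_norm_cancel[OF series_summable_norm])
    then show ?thesis unfolding H_def by (intro infsumI has_sum_cmult_right)
  qed
  have "(\<lambda>(z, n). H n z) summable_on UNIV \<times> UNIV"
    using HS summable_on_swap[of "\<lambda>(n, z). H n z" UNIV UNIV] by simp
  from summable_on_Sigma_banach[OF this]
  show "(\<lambda>z. of_real (p x z) * G z y) summable_on UNIV" unfolding col .
  have rowH: "(\<Sum>\<^sub>\<infinity>z. H n z) = of_real (pn p (Suc n) x y) / lam ^ Suc n" for n
  proof -
    have "((\<lambda>z. of_real (p x z * pn p n z y) :: 'a) has_sum of_real (pn p (Suc n) x y)) UNIV"
      using pn_has_sum by (rule has_sum_of_real)
    from has_sum_cmult_left[OF this, of "inverse (lam ^ Suc n)"] show ?thesis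
      unfolding H_def by (intro infsumI) (simp add: divide_inverse mult.assoc del: pn.simps(2))
  qed
  have "(\<Sum>\<^sub>\<infinity>z. of_real (p x z) * G z y) = (\<Sum>\<^sub>\<infinity>n. of_real (pn p (Suc n) x y) / lam ^ Suc n)"
    using infsum_swap_banach[OF HS] unfolding col rowH by simp
  also have "\<dots> = lam * G x y - (if x = y then 1 else 0)"
  proof (rule infsumI, rule norm_summable_imp_has_sum)
    show "summable (\<lambda>n. norm (of_real (pn p (Suc n) x y) / lam ^ Suc n))"
      using rows pn_bounds lam
      by (simp add: norm_divide norm_mult norm_power norm_inverse divide_inverse del: pn.simps(2))
    have "(\<lambda>n. lam * (of_real (pn p n x y) / lam ^ Suc n)) sums (lam * G x y)"
      unfolding G_def
      by (intro sums_mult summable_sums summable_norm_cancel[OF series_summable_norm] lam)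
    then have "(\<lambda>n. of_real (pn p n x y) / lam ^ n) sums (lam * G x y)"
      using lam0 by simp
    \<comment> \<open>The term n = 0 split off here is the right-hand side of the resolvent
      equation.\<close>
    then have "(\<lambda>n. of_real (pn p (Suc n) x y) / lam ^ Suc n) sums (lam * G x y - of_real (pn p 0 x y) / lam ^ 0)"
      by (subst sums_Suc_iff) simp
    then show "(\<lambda>n. of_real (pn p (Suc n) x y) / lam ^ Suc n) sums (lam * G x y - (if x = y then 1 else 0))"
      by (cases "x = y") (simp_all del: pn.simps(2))
  qed
  finally show "lam * G x y - (\<Sum>\<^sub>\<infinity>z. of_real (p x z) * G z y) = (if x = y then 1 else 0)" by simp
qed

text \<open>The first-passage generating function \<Phi> depends on x and w alone, so it cancels
  between the factorisations for the targets y and w.\<close>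

lemma Gser_separation:
  assumes lam: "cmod lam = r" and w: "w \<in> A"
    and A: "\<And>z z'. z \<in> A \<Longrightarrow> z \<noteq> w \<Longrightarrow> adj z z' \<Longrightarrow> z' \<in> A"
    and y: "y \<notin> A - {w}" and x: "x \<in> A"
  shows "Gser p lam x y * Gser p lam w w = Gser p lam x w * Gser p lam w y"
proof -
  define \<Phi> where "\<Phi> = (\<Sum>k. complex_of_real (first_passage p w k x) / lam ^ k)"
  have fs: "summable (\<lambda>k. norm (complex_of_real (first_passage p w k x) / lam ^ k))"
  proof (rule summable_comparison_test')
    show "summable (\<lambda>k. r * (pn p k x w / r ^ Suc k))" by (intro summable_mult ser)
    fix k
    have "first_passage p w k x / r ^ k \<le> pn p k x w / r ^ k"
      using first_passage_bounds r by (intro divide_right_mono) auto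
    then show "norm (norm (complex_of_real (first_passage p w k x) / lam ^ k)) \<le> r * (pn p k x w / r ^ Suc k)"
      using first_passage_bounds[of w k x] r lam by (simp add: norm_divide norm_power)
  qed
  have *: "Gser p lam x y' = \<Phi> * Gser p lam w y'" if y': "y' \<notin> A - {w}" for y'
  proof -
    have "\<Phi> * Gser p lam w y' = (\<Sum>n. \<Sum>k\<le>n. complex_of_real (first_passage p w k x) / lam ^ k *
        (complex_of_real (pn p (n - k) w y') / lam ^ Suc (n - k)))"
      unfolding \<Phi>_def Gser_def by (rule Cauchy_product[OF fs series_summable_norm[OF lam]])
    also have "\<dots> = Gser p lam x y'"
      unfolding Gser_def
    proof (rule arg_cong[of _ _ suminf], rule ext)
      fix n
      have "(\<Sum>k\<le>n. complex_of_real (first_passage p w k x) / lam ^ k *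
        (complex_of_real (pn p (n - k) w y') / lam ^ Suc (n - k)))
        = (\<Sum>k\<le>n. complex_of_real (first_passage p w k x * pn p (n - k) w y') / lam ^ Suc n)"
        by (intro sum.cong) (auto simp: power_add[symmetric])
      also have "\<dots> = complex_of_real (pn p n x y') / lam ^ Suc n"
      proof -
        have "pn p n x y' = (\<Sum>k\<le>n. first_passage p w k x * pn p (n - k) w y')"
          by (rule pn_first_passage[OF w _ y' x]) (rule A)
        then show ?thesis by (simp only: of_real_sum sum_divide_distrib)
      qed
      finally show "(\<Sum>k\<le>n. complex_of_real (first_passage p w k x) / lam ^ k *
        (complex_of_real (pn p (n - k) w y') / lam ^ Suc (n - k)))
        = complex_of_real (pn p n x y') / lam ^ Suc n" .
    qed
    finally show ?thesis by simp
  qed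
  show ?thesis using *[OF y] *[of w] by simp
qed

lemma real_series_pos: "(\<Sum>n. pn p n x y / r ^ Suc n) > 0"
proof -
  obtain n where "pn p n x y > 0" using pn_pos by blast
  then show ?thesis using ser[of x y] pn_bounds r by (intro suminf_pos2[where i = n]) auto
qed

text \<open>Return times are even, so replacing r by -r flips the sign of every term and the
  diagonal value stays nonzero.\<close>

lemma Gser_diag_nonzero:
  assumes "lam = complex_of_real r \<or> lam = - complex_of_real r" shows "Gser p lam x x \<noteq> 0"
proof -
  let ?S = "\<Sum>n. pn p n x x / r ^ Suc n"
  have S: "complex_of_real ?S = (\<Sum>n. complex_of_real (pn p n x x / r ^ Suc n))"
    by (rule suminf_of_real[OF ser])
  have "Gser p lam x x = complex_of_real ?S \<or> Gser p lam x x = - complex_of_real ?S"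
    using assms
  proof
    assume "lam = complex_of_real r"
    then show ?thesis unfolding S by (simp add: Gser_def)
  next
    assume l: "lam = - complex_of_real r"
    have "complex_of_real (pn p n x x) / lam ^ Suc n = - complex_of_real (pn p n x x / r ^ Suc n)" for n
    proof (cases "pn p n x x = 0")
      case False
      from pn_parity[OF False] have "even n" by (cases "even (length (gl x))") auto
      then have "lam ^ Suc n = - complex_of_real (r ^ Suc n)" unfolding l by (simp del: power_Suc)
      then show ?thesis by (simp del: power_Suc)
    qed simp
    then have "Gser p lam x x = (\<Sum>n. - complex_of_real (pn p n x x / r ^ Suc n))"
      unfolding Gser_def by simp
    also have "\<dots> = - complex_of_real ?S"
      unfolding S by (rule suminf_minus[OF summable_of_real[OF ser]])
    finally show ?thesis ..
  qed
  then show ?thesis using real_series_pos[of x x] by auto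
qed

lemma green_kernel_Gser:
  assumes lam: "lam = complex_of_real r \<or> lam = - complex_of_real r"
  shows "green_kernel adj p lam (Green adj p rt lam)"
proof -
  have nl: "cmod lam = r" using lam r by auto
  show ?thesis
  proof (cases "lam \<in> resP adj p rt")
    case True
    \<comment> \<open>The series at +r also when lam = -r, as only |lam| enters. It is superharmonic
      because r f - Pf is the indicator of the root.\<close>
    define f where "f x = (\<Sum>n. pn p n x rt / r ^ Suc n)" for x
    have f: "(\<lambda>z. p x z * f z) summable_on UNIV"
      "r * f x - (\<Sum>\<^sub>\<infinity>z. p x z * f z) = (if x = rt then 1 else 0)" for x
      using series_resolvent[of r x rt] r unfolding f_def by simp_all
    show ?thesis
    proof (rule green_kernel_Gres[OF True], rule Gres_diag_nonzero[OF True])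
      show "f x > 0" for x unfolding f_def by (rule real_series_pos)
      show "(\<lambda>z. p x z * f z) summable_on UNIV" for x by (rule f)
      show "(\<Sum>\<^sub>\<infinity>z. p x z * f z) \<le> cmod lam * f x" for x
        using f(2)[of x] unfolding nl by (simp split: if_splits)
    qed
  next
    case False
    then have G: "Green adj p rt lam = Gser p lam" by (intro ext) (simp add: Green_def)
    show ?thesis
      unfolding green_kernel_def G
    proof (intro conjI allI impI)
      show "(\<lambda>z. complex_of_real (p x z) * Gser p lam z y) summable_on UNIV" for x y
        unfolding Gser_def by (rule series_resolvent(1)[OF nl])
      show "lam * Gser p lam x y - (\<Sum>\<^sub>\<infinity>z. complex_of_real (p x z) * Gser p lam z y) = (if x = y then 1 else 0)"
        for x y
        unfolding Gser_def by (rule series_resolvent(2)[OF nl])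
    qed (use Gser_diag_nonzero[OF lam] Gser_separation[OF nl] in blast)+
  qed
qed

end

end

theorem theorem3p2:
  fixes adj :: "'v::countable \<Rightarrow> 'v \<Rightarrow> bool"
    and p :: "'v \<Rightarrow> 'v \<Rightarrow> real"
    and rt :: 'v
    and lam :: complex
    and h :: "'v \<Rightarrow> complex"
  assumes tree: "is_tree adj"
    and no_leaf: "\<forall>x. \<not> (\<exists>!y. adj x y)"
    and stoch: "stochastic_nn adj p"
    and lam: "lam \<in> resP_star adj p rt \<or>
              (rho_transient p rt \<and> (lam = complex_of_real (rho p rt) \<or> lam = - complex_of_real (rho p rt)))"
  shows "(is_eigenfun p lam h \<longleftrightarrow>
           (\<exists>\<nu>. complex_distribution adj rt \<nu> \<and>
                (\<forall>x. h x = lc_integral adj rt \<nu> (Kmartin adj p rt lam x))))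
       \<and> (\<forall>\<nu>. complex_distribution adj rt \<nu> \<and>
                (\<forall>x. h x = lc_integral adj rt \<nu> (Kmartin adj p rt lam x))
              \<longrightarrow> (\<forall>x. \<nu> (bdT adj rt x) = nu_h adj p rt lam h x))"
proof -
  interpret W: tree_walk adj rt p
    using tree no_leaf stoch by unfold_locales auto
  have "green_kernel adj p lam (Green adj p rt lam)"
    using lam
  proof
    assume l: "lam \<in> resP_star adj p rt"
    then have res: "lam \<in> resP adj p rt" by (simp add: resP_star_def)
    show ?thesis
      by (rule W.green_kernel_Gres[OF res]) (use l res in \<open>auto simp: resP_star_def Green_def\<close>)
  next
    assume l: "rho_transient p rt \<and> (lam = complex_of_real (rho p rt) \<or> lam = - complex_of_real (rho p rt))"
    show ?thesis
      by (rule W.green_kernel_Gser[OF W.rho_pos]) (use l in \<open>auto simp: rho_transient_def\<close>)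
  qed
  then interpret green_walk adj rt p lam
    by unfold_locales
  show ?thesis by (rule poisson_martin)
qed

end
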